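(* Let $L/K$ be a strongly separable totally ramified extension of local fields of residue characteristic $p$, of degree $n=[L:K]$. Then $$\text{Lower-Convex-Hull}\big(\{(p^{\beta_{L/K}(i)-1},\,p^{\beta_{L/K}(i)-1}i): i\in I_{L/K}\}\cup\{(n,n)\}\big)=\mathrm{Newt}(L/K).$$ Moreover, if $L/K$ is given by an Eisenstein polynomial $g(x)$ over $K$ (i.e. $L=K[x]/g(x)$), then $$(I_{L/K},\beta_{L/K})=(I_{g(x)},\beta_{g(x)}).$$
   Context: Local fields: non-archimedean, non-discrete, locally compact; $v_K$ normalized valuation ($v_K(p)=\infty$ in characteristic $p$), $U_i(K)=1+m_K^i$, $U_1(K)$ is a $\mathbb{Z}_p$-module. An extension $F/E$ of local fields of residue characteristic $p$ is strongly separable if $v_F(\delta_{F/E})<v_F(p)$, $\delta_{F/E}$ being the different. Newton polygon: for a totally ramified separable extension $L/K$ of degree $n$, write $L=K[x]/g(x)$ with $g$ Eisenstein of degree $n$ over $K$, let $\pi$ be a root of $g$ in a separable closure, and let $g_{\mathrm{twist}}(t)=g(\pi t+\pi)=\sum_kc_kt^k\in K(\pi)[t]$. $\mathrm{Newt}(L/K)$ is the lower convex hull of the points $(k,v_{K(\pi)}(c_k))$ with $c_k\neq0$; it does not depend on the choices of $g$ and $\pi$. Lower-Convex-Hull of a finite set of points in the plane is the lower boundary of its convex hull. Jump sets: a shift is a strictly increasing $\rho:\mathbb{Z}_{\ge1}\to\mathbb{Z}_{\ge1}$ with $\rho(1)>1$; $T_\rho=\mathbb{Z}_{\ge1}\setminus\rho(\mathbb{Z}_{\ge1})$.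 $\rho_{e,p}(i)=\min\{i+e,pi\}$ for $e\in\mathbb{Z}_{>0}\cup\{\infty\}$. A $\rho$-jump set is a pair $(I,\beta)$ with $I\subseteq T_\rho$ finite and $\beta:I\to\mathbb{Z}_{\ge1}$ strictly decreasing such that $i\mapsto\rho^{\beta(i)}(i)$ is strictly increasing on $I$. On $\mathbb{Z}_{\ge1}^2$ let $(a_1,b_1)\le_\rho(a_2,b_2)$ iff $b_2\ge b_1$ and $\rho^{b_2}(a_2)\ge\rho^{b_1}(a_1)$. Definition of $(I_g,\beta_g)$: for a strongly separable Eisenstein polynomial $g(x)=\sum_{i=0}^na_ix^i$ ($a_n=1$) over $K$, let $$S_g=\Big\{\Big(\tfrac{v_K(a_i)\,n+i}{p^{v_{\mathbb{Q}_p}(i)}},\,v_{\mathbb{Q}_p}(i)+1\Big):1\le i\le n,\ v_{\mathbb{Q}_p}(i)\le v_{\mathbb{Q}_p}(n),\ a_i\ne0\Big\}.$$ The set of minimal elements of $S_g$ with respect to $\le_{\rho_{\infty,p}}$ is the graph of $\beta_g$ for a unique $\rho_{\infty,p}$-jump set $(I_g,\beta_g)$. Definition of $(I_{L/K},\beta_{L/K})$: let $e_L=v_L(p)$. For $u\in U_1(K)\setminus U_2(K)$ and $k\in\mathbb{Z}_{\ge0}$ let $g_u(k)=\sup\{i\ge1:u\in U_i(L)\cdot U_1(L)^{p^k}\}\in\mathbb{Z}_{\ge1}\cup\{\infty\}$ (the weight of $u$ in $U_1(L)/U_1(L)^{p^k}$ with the quotient filtration), and say $g_u$ breaks at $k$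 if $g_u(k)\neq g_u(k+1)$. $(I_{L/K}(u),\beta_{L/K}(u))=(I,\beta)$ is the unique $\rho_{e_L,p}$-jump set such that $g_u$ breaks at $k$ if and only if $k\in\{\beta(i)-1:i\in I\}$, and $g_u(\beta(i))=\rho_{e_L,p}^{\beta(i)-1}(i)$ for each $i\in I$. When $L/K$ is strongly separable this jump set does not depend on $u\in U_1(K)\setminus U_2(K)$ (and is also a $\rho_{\infty,p}$-jump set); it is denoted $(I_{L/K},\beta_{L/K})$. *)

theory Defs
  imports "HOL-Analysis.Analysis" "HOL-Computational_Algebra.Computational_Algebra"
begin

section \<open>Local fields\<close>

text \<open>
  A field type is equipped with a valuation \<open>v :: 'a \<Rightarrow> int\<close>.  The convention \<open>v 0 = \<infinity>\<close> is not
  encoded in the value of \<open>v\<close> at 0, which is arbitrary: every use of \<open>v\<close> below treats 0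
  separately.
\<close>

definition ideal_pow :: "('a::field \<Rightarrow> int) \<Rightarrow> nat \<Rightarrow> 'a set" where
  "ideal_pow v i = {x. x = 0 \<or> int i \<le> v x}"

abbreviation valuation_ring :: "('a::field \<Rightarrow> int) \<Rightarrow> 'a set" where
  "valuation_ring v \<equiv> ideal_pow v 0"

abbreviation max_ideal :: "('a::field \<Rightarrow> int) \<Rightarrow> 'a set" where
  "max_ideal v \<equiv> ideal_pow v 1"

definition unit_grp :: "('a::field \<Rightarrow> int) \<Rightarrow> nat \<Rightarrow> 'a set" where
  "unit_grp v i = {1 + x | x. x \<in> ideal_pow v i}"

definition enat_val :: "('a::field \<Rightarrow> int) \<Rightarrow> 'a \<Rightarrow> enat" where
  "enat_val v x = (if x = 0 then \<infinity> else enat (nat (v x)))"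
  \<comment> \<open>the valuation with \<open>v 0 = \<infinity>\<close>; meaningful only on the valuation ring\<close>

definition valuation_topology :: "('a::field \<Rightarrow> int) \<Rightarrow> 'a topology" where
  "valuation_topology v =
     topology (\<lambda>U. \<forall>x\<in>U. \<exists>i. (\<lambda>y. x + y) ` ideal_pow v i \<subseteq> U)"

lemma openin_valuation_topology:
  "openin (valuation_topology v) U \<longleftrightarrow> (\<forall>x\<in>U. \<exists>i. (\<lambda>y. x + y) ` ideal_pow v i \<subseteq> U)"
proof -
  have "istopology (\<lambda>U. \<forall>x\<in>U. \<exists>i. (\<lambda>y. x + y) ` ideal_pow v i \<subseteq> U)"
    unfolding istopology_def
  proof (intro conjI allI impI ballI)
    fix S T x
    assume S: "\<forall>x\<in>S. \<exists>i. (\<lambda>y. x + y) ` ideal_pow v i \<subseteq> S"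
      and T: "\<forall>x\<in>T. \<exists>i. (\<lambda>y. x + y) ` ideal_pow v i \<subseteq> T" and x: "x \<in> S \<inter> T"
    obtain i j where ij: "(\<lambda>y. x + y) ` ideal_pow v i \<subseteq> S" "(\<lambda>y. x + y) ` ideal_pow v j \<subseteq> T"
      using S T x by blast
    have "ideal_pow v (max i j) \<subseteq> ideal_pow v i \<inter> ideal_pow v j"
      by (auto simp: ideal_pow_def)
    then show "\<exists>i. (\<lambda>y. x + y) ` ideal_pow v i \<subseteq> S \<inter> T"
      using ij by blast
  next
    fix \<K> x
    assume a: "\<forall>U\<in>\<K>. \<forall>x\<in>U. \<exists>i. (\<lambda>y. x + y) ` ideal_pow v i \<subseteq> U" and x: "x \<in> \<Union>\<K>"
    from x obtain U where U: "U \<in> \<K>" "x \<in> U" by blast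
    with a obtain i where "(\<lambda>y. x + y) ` ideal_pow v i \<subseteq> U" by blast
    with U show "\<exists>i. (\<lambda>y. x + y) ` ideal_pow v i \<subseteq> \<Union>\<K>" by blast
  qed
  then show ?thesis
    by (simp add: valuation_topology_def)
qed

text \<open>
  A local field together with its normalized valuation.  The existence of \<open>x \<noteq> 0\<close> with
  \<open>v x = 1\<close> says that \<open>v\<close> is onto the integers; it also makes the topology non-discrete.
\<close>

locale local_field =
  fixes v :: "'a::field \<Rightarrow> int"
  assumes val_mult: "x \<noteq> 0 \<Longrightarrow> y \<noteq> 0 \<Longrightarrow> v (x * y) = v x + v y"
    and val_add: "x \<noteq> 0 \<Longrightarrow> y \<noteq> 0 \<Longrightarrow> x + y \<noteq> 0 \<Longrightarrow> min (v x) (v y) \<le> v (x + y)"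
    and val_normalized: "\<exists>x. x \<noteq> 0 \<and> v x = 1"
    and locally_compact: "locally_compact_space (valuation_topology v)"

definition residue_characteristic :: "('a::field \<Rightarrow> int) \<Rightarrow> nat \<Rightarrow> bool" where
  "residue_characteristic v p \<longleftrightarrow> prime p \<and> of_nat p \<in> max_ideal v"


section \<open>Extensions of local fields\<close>

text \<open>
  An extension \<open>L/K\<close> is given by a field homomorphism \<open>\<iota>\<close> from the type of \<open>K\<close> to the type of
  \<open>L\<close>, through which \<open>L\<close> is a vector space over \<open>K\<close>.
\<close>

definition ext_scale :: "('k::field \<Rightarrow> 'l::field) \<Rightarrow> 'k \<Rightarrow> 'l \<Rightarrow> 'l" where
  "ext_scale \<iota> a x = \<iota> a * x"

definition ext_degree :: "('k::field \<Rightarrow> 'l::field) \<Rightarrow> nat" where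
  "ext_degree \<iota> = vector_space.dim (ext_scale \<iota>) UNIV"
  \<comment> \<open>0 if the extension is infinite\<close>

locale local_field_extension =
  K: local_field vK + L: local_field vL
  for vK :: "'k::field \<Rightarrow> int" and vL :: "'l::field \<Rightarrow> int" +
  fixes \<iota> :: "'k \<Rightarrow> 'l"
  assumes hom_one: "\<iota> 1 = 1"
    and hom_add: "\<iota> (x + y) = \<iota> x + \<iota> y"
    and hom_mult: "\<iota> (x * y) = \<iota> x * \<iota> y"
    and finite_degree: "ext_degree \<iota> > 0"
    and val_extends: "\<exists>e>0. \<forall>x. x \<noteq> 0 \<longrightarrow> vL (\<iota> x) = e * vK x"

text \<open>Ramification index equal to the degree.\<close>

definition totally_ramified ::
    "('k::field \<Rightarrow> int) \<Rightarrow> ('l::field \<Rightarrow> int) \<Rightarrow> ('k \<Rightarrow> 'l) \<Rightarrow> bool" where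
  "totally_ramified vK vL \<iota> \<longleftrightarrow> (\<forall>x. x \<noteq> 0 \<longrightarrow> vL (\<iota> x) = int (ext_degree \<iota>) * vK x)"

definition separable_extension :: "('k::field \<Rightarrow> 'l::field) \<Rightarrow> bool" where
  "separable_extension \<iota> \<longleftrightarrow>
     (\<forall>x. \<exists>f :: 'k poly. coprime f (pderiv f) \<and> poly (map_poly \<iota> f) x = 0)"

text \<open>The trace of multiplication by \<open>x\<close>, computed in any \<open>K\<close>-basis of \<open>L\<close>.\<close>

definition ext_trace :: "('k::field \<Rightarrow> 'l::field) \<Rightarrow> 'l \<Rightarrow> 'k" where
  "ext_trace \<iota> x = (THE t. \<forall>B.
     \<not> module.dependent (ext_scale \<iota>) B \<and> module.span (ext_scale \<iota>) B = UNIV \<longrightarrow>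
       t = (\<Sum>b\<in>B. module.representation (ext_scale \<iota>) B (x * b) b))"

definition codifferent ::
    "('k::field \<Rightarrow> int) \<Rightarrow> ('l::field \<Rightarrow> int) \<Rightarrow> ('k \<Rightarrow> 'l) \<Rightarrow> 'l set" where
  "codifferent vK vL \<iota> =
     {x. \<forall>y\<in>valuation_ring vL. ext_trace \<iota> (x * y) \<in> valuation_ring vK}"

definition different_ideal ::
    "('k::field \<Rightarrow> int) \<Rightarrow> ('l::field \<Rightarrow> int) \<Rightarrow> ('k \<Rightarrow> 'l) \<Rightarrow> 'l set" where
  "different_ideal vK vL \<iota> = {x. \<forall>y\<in>codifferent vK vL \<iota>. x * y \<in> valuation_ring vL}"

text \<open>
  Separability is implied by the inequality: for an inseparable extension the trace vanishes
  and the different defined above is the zero ideal, of valuation \<open>\<infinity>\<close>.  It is included because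
  the different is usually considered for separable extensions only.
\<close>

definition strongly_separable ::
    "nat \<Rightarrow> ('k::field \<Rightarrow> int) \<Rightarrow> ('l::field \<Rightarrow> int) \<Rightarrow> ('k \<Rightarrow> 'l) \<Rightarrow> bool" where
  "strongly_separable p vK vL \<iota> \<longleftrightarrow>
     separable_extension \<iota> \<and>
     (INF x\<in>different_ideal vK vL \<iota>. enat_val vL x) < enat_val vL (of_nat p)"


section \<open>Eisenstein polynomials and the Newton polygon\<close>

definition eisenstein :: "('k::field \<Rightarrow> int) \<Rightarrow> 'k poly \<Rightarrow> bool" where
  "eisenstein v g \<longleftrightarrow> degree g > 0 \<and> lead_coeff g = 1 \<and>
     (\<forall>i<degree g. coeff g i \<in> max_ideal v) \<and> coeff g 0 \<notin> ideal_pow v 2"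

text \<open>
  \<open>L = K[x]/g(x)\<close>, with \<open>\<pi>\<close> the class of \<open>x\<close>: evaluation at \<open>\<pi>\<close> is onto with kernel \<open>(g)\<close>.
\<close>

definition presents :: "('k::field \<Rightarrow> 'l::field) \<Rightarrow> 'k poly \<Rightarrow> 'l \<Rightarrow> bool" where
  "presents \<iota> g \<pi> \<longleftrightarrow> surj (\<lambda>f :: 'k poly. poly (map_poly \<iota> f) \<pi>) \<and>
     (\<forall>f. poly (map_poly \<iota> f) \<pi> = 0 \<longleftrightarrow> g dvd f)"

definition twist_poly :: "('k::field \<Rightarrow> 'l::field) \<Rightarrow> 'k poly \<Rightarrow> 'l \<Rightarrow> 'l poly" where
  "twist_poly \<iota> g \<pi> = pcompose (map_poly \<iota> g) [:\<pi>, \<pi>:]"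

definition lower_convex_hull :: "(real \<times> real) set \<Rightarrow> (real \<times> real) set" where
  "lower_convex_hull S =
     {(x, y). (x, y) \<in> convex hull S \<and> (\<forall>y'. (x, y') \<in> convex hull S \<longrightarrow> y \<le> y')}"

definition newton_polygon :: "('l::field \<Rightarrow> int) \<Rightarrow> 'l poly \<Rightarrow> (real \<times> real) set" where
  "newton_polygon v h =
     lower_convex_hull {(real k, real_of_int (v (coeff h k))) | k. coeff h k \<noteq> 0}"

text \<open>
  The root \<open>\<pi>\<close> of \<open>g\<close> is taken in \<open>L\<close> rather than in a separable closure; \<open>K(\<pi>)\<close> is then \<open>L\<close>.
  The description operator expresses independence of the choice of \<open>g\<close> and \<open>\<pi>\<close>.
\<close>

definition Newt ::
    "('k::field \<Rightarrow> int) \<Rightarrow> ('l::field \<Rightarrow> int) \<Rightarrow> ('k \<Rightarrow> 'l) \<Rightarrow> (real \<times> real) set" where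
  "Newt vK vL \<iota> = (THE N. \<exists>g \<pi>. eisenstein vK g \<and> presents \<iota> g \<pi> \<and>
     N = newton_polygon vL (twist_poly \<iota> g \<pi>))"


section \<open>Jump sets\<close>

definition shift_rho :: "enat \<Rightarrow> nat \<Rightarrow> nat \<Rightarrow> nat" where
  "shift_rho e p i = the_enat (min (enat i + e) (enat (p * i)))"

text \<open>Functions on \<open>I\<close> are extensional, so that a jump set is determined by the graph of \<open>\<beta>\<close>.\<close>

definition jump_set :: "(nat \<Rightarrow> nat) \<Rightarrow> nat set \<times> (nat \<Rightarrow> nat) \<Rightarrow> bool" where
  "jump_set \<rho> = (\<lambda>(I, \<beta>). finite I \<and> I \<subseteq> {1..} - \<rho> ` {1..} \<and> \<beta> \<in> I \<rightarrow>\<^sub>E {1..} \<and>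
     strict_antimono_on I \<beta> \<and> strict_mono_on I (\<lambda>i. (\<rho> ^^ \<beta> i) i))"

definition jump_le :: "(nat \<Rightarrow> nat) \<Rightarrow> nat \<times> nat \<Rightarrow> nat \<times> nat \<Rightarrow> bool" where
  "jump_le \<rho> = (\<lambda>(a1, b1) (a2, b2). b2 \<ge> b1 \<and> (\<rho> ^^ b2) a2 \<ge> (\<rho> ^^ b1) a1)"

definition minimal_elements :: "('a \<Rightarrow> 'a \<Rightarrow> bool) \<Rightarrow> 'a set \<Rightarrow> 'a set" where
  "minimal_elements le S = {x\<in>S. \<forall>y\<in>S. le y x \<longrightarrow> y = x}"

text \<open>For Eisenstein \<open>g\<close>, \<open>nat\<close> does not truncate and the division below is exact.\<close>

definition poly_points :: "nat \<Rightarrow> ('k::field \<Rightarrow> int) \<Rightarrow> 'k poly \<Rightarrow> (nat \<times> nat) set" where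
  "poly_points p v g =
     {((nat (v (coeff g i)) * degree g + i) div p ^ multiplicity p i, multiplicity p i + 1) | i.
        1 \<le> i \<and> i \<le> degree g \<and> multiplicity p i \<le> multiplicity p (degree g) \<and> coeff g i \<noteq> 0}"

definition poly_jump_set ::
    "nat \<Rightarrow> ('k::field \<Rightarrow> int) \<Rightarrow> 'k poly \<Rightarrow> nat set \<times> (nat \<Rightarrow> nat)" where
  "poly_jump_set p v g = (THE (I, \<beta>). jump_set (shift_rho \<infinity> p) (I, \<beta>) \<and>
     (\<lambda>i. (i, \<beta> i)) ` I = minimal_elements (jump_le (shift_rho \<infinity> p)) (poly_points p v g))"

text \<open>The weight of \<open>u\<close> modulo \<open>p^k\<close>-th powers of principal units.\<close>

definition unit_weight :: "nat \<Rightarrow> ('l::field \<Rightarrow> int) \<Rightarrow> 'l \<Rightarrow> nat \<Rightarrow> enat" where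
  "unit_weight p v u k =
     Sup {enat i | i. 1 \<le> i \<and> (\<exists>x\<in>unit_grp v i. \<exists>y\<in>unit_grp v 1. u = x * y ^ (p ^ k))}"

definition unit_jump_set :: "nat \<Rightarrow> ('l::field \<Rightarrow> int) \<Rightarrow> 'l \<Rightarrow> nat set \<times> (nat \<Rightarrow> nat)" where
  "unit_jump_set p v u = (THE (I, \<beta>).
     (let \<rho> = shift_rho (enat_val v (of_nat p)) p; w = unit_weight p v u in
       jump_set \<rho> (I, \<beta>) \<and>
       (\<forall>k. w k \<noteq> w (k + 1) \<longleftrightarrow> k \<in> (\<lambda>i. \<beta> i - 1) ` I) \<and>
       (\<forall>i\<in>I. w (\<beta> i) = enat ((\<rho> ^^ (\<beta> i - 1)) i))))"

text \<open>The common value for all \<open>u \<in> U\<^sub>1(K) - U\<^sub>2(K)\<close>.\<close>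

definition ext_jump_set ::
    "nat \<Rightarrow> ('k::field \<Rightarrow> int) \<Rightarrow> ('l::field \<Rightarrow> int) \<Rightarrow> ('k \<Rightarrow> 'l) \<Rightarrow> nat set \<times> (nat \<Rightarrow> nat)" where
  "ext_jump_set p vK vL \<iota> =
     (THE J. \<forall>u \<in> unit_grp vK 1 - unit_grp vK 2. unit_jump_set p vL (\<iota> u) = J)"

end

theory Submission
  imports Defs "HOL-Algebra.Exponent"
begin

text \<open>
  Let \<open>g = \<Sum> a\<^sub>i X\<^sup>i\<close> be Eisenstein over \<open>K\<close> with root \<open>\<pi>\<close> in \<open>L\<close>.  The terms of
  \<open>- a\<^sub>0 = \<Sum> a\<^sub>i \<pi>\<^sup>i\<close>, \<open>1 \<le> i \<le> n\<close>, have the valuations \<open>h i = n v(a\<^sub>i) + i\<close>, which are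
  distinct because they are distinct modulo \<open>n\<close>.  Let \<open>low k\<close> be the minimum of \<open>h i\<close> over the
  indices \<open>i\<close> that are not divisible by \<open>p\<^sup>k\<close>.  Both jump sets and the Newton polygon are
  determined by the decreasing function \<open>low\<close>, through its breaks, the \<open>k\<close> with
  \<open>low (k + 1) \<noteq> low k\<close>; \<open>k = 0\<close> is always counted as a break.

  Strong separability enters only as \<open>low 1 \<le> v\<^sub>L(p)\<close> (\<open>strongly_separable_index\<close>).
  Otherwise \<open>p\<close> divides \<open>g'(\<pi>)\<close>, and by Euler's formula for the trace (\<open>trace_eq\<close>) the
  codifferent contains \<open>1/p\<close>, or is all of \<open>L\<close> if \<open>p = 0\<close>.

  For \<open>k \<ge> 1\<close>, a unit \<open>u\<close> in \<open>U\<^sub>1(K) - U\<^sub>2(K)\<close> has weight exactly \<open>low k\<close> modulo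
  \<open>p\<^sup>k\<close>-th powers (\<open>unit_weight_eq_low\<close>).  As long as \<open>N \<le> v\<^sub>L(p)\<close>, the \<open>p\<^sup>k\<close>-th powers of
  integers of \<open>L\<close> form a ring \<open>P\<^sub>N\<close> modulo \<open>\<pi>\<^sup>N\<close>.  Since the residue field is perfect,
  \<open>P\<^sub>N\<close> contains all integers of \<open>K\<close> as soon as it contains one uniformizer of \<open>K\<close>.  If it
  does for some \<open>N < low k\<close>, then in the expansion of \<open>a\<^sub>0\<close> the terms with \<open>p\<^sup>k\<close> dividing \<open>i\<close>
  lie in \<open>P\<^sub>N\<^sub>+\<^sub>1\<close>, as \<open>\<pi>\<^sup>i\<close> is a power and improves the precision, and the other terms vanish
  modulo \<open>\<pi>\<^sup>N\<^sup>+\<^sup>1\<close>.  By induction \<open>u\<close> lies in \<open>P\<^sub>N\<close> for \<open>N = low k\<close>.  For \<open>N = low k + 1\<close> it does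
  not: exactly one of the other terms survives, its valuation is \<open>low k\<close>, and this number is never
  divisible by \<open>p\<^sup>k\<close> (\<open>not_dvd_low\<close>).  Only if \<open>p\<^sup>k\<close> does not divide \<open>n\<close> may \<open>low k + 1\<close> exceed
  \<open>v\<^sub>L(p)\<close>; then \<open>low k = n\<close>, and the expansion of \<open>(1 + z)\<close> to the power \<open>p\<^sup>k\<close> shows directly that
  it is too far from \<open>u\<close>.

  So \<open>I\<close> consists of the numbers \<open>low (k + 1) / p\<^sup>k\<close> and \<open>\<beta>\<close> takes the value \<open>k + 1\<close> there, for
  \<open>k\<close> a break.  The minimal points of \<open>S\<^sub>g\<close> are the same pairs (\<open>minimal_points\<close>).  The \<open>k\<close>-th
  coefficient of the twisted polynomial is \<open>\<Sum> (i choose k) a\<^sub>i \<pi>\<^sup>i\<close>; divisibility of binomial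
  coefficients shows that its valuation is at least \<open>low (m + 1)\<close>, where \<open>m\<close> is the exponent of
  \<open>p\<close> in \<open>k\<close>, with equality if \<open>k = p\<^sup>m\<close> and \<open>m\<close> is a break.  Hence the points
  \<open>(p\<^sup>k, low (k + 1))\<close> for breaks \<open>k\<close>, together with \<open>(n, n)\<close>, span the Newton polygon.
\<close>

section \<open>Valuations\<close>

context local_field
begin

lemma val_one [simp]: "v 1 = 0"
  using val_mult[of 1 1] by simp

lemma val_minus [simp]: "v (- x) = v x"
proof (cases "x = 0")
  case False
  have "v (-1) = 0"
    using val_mult[of "-1" "-1"] by simp
  with False show ?thesis
    using val_mult[of "-1" x] by simp
qed simp

lemma val_power: "x \<noteq> 0 \<Longrightarrow> v (x ^ k) = int k * v x"
  by (induction k) (auto simp: val_mult algebra_simps)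

lemma val_inverse:
  assumes "x \<noteq> 0" shows "v (inverse x) = - v x"
  using val_mult[of x "inverse x"] assms by simp

lemma val_divide: "x \<noteq> 0 \<Longrightarrow> y \<noteq> 0 \<Longrightarrow> v (x / y) = v x - v y"
  by (simp add: divide_inverse val_mult val_inverse)

lemma val_add_less:
  assumes "x \<noteq> 0" "y \<noteq> 0" "v x < v y"
  shows "x + y \<noteq> 0 \<and> v (x + y) = v x"
proof
  show nz: "x + y \<noteq> 0"
    using assms by (metis add_eq_0_iff less_irrefl val_minus)
  have "min (v (x + y)) (v y) \<le> v x"
    using val_add[of "x + y" "- y"] assms nz by simp
  moreover have "v x \<le> v (x + y)"
    using val_add[of x y] assms nz by simp
  ultimately show "v (x + y) = v x"
    using assms by linarith
qed

lemma val_sum_distinct: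
  assumes "finite A" "A \<noteq> {}" "\<And>i. i \<in> A \<Longrightarrow> x i \<noteq> 0" "inj_on (\<lambda>i. v (x i)) A"
  shows "\<exists>j\<in>A. sum x A \<noteq> 0 \<and> v (sum x A) = v (x j) \<and> (\<forall>i\<in>A. v (x j) \<le> v (x i))"
  using assms
proof (induction A rule: finite_ne_induct)
  case (singleton a)
  then show ?case by simp
next
  case (insert a F)
  then obtain j where j: "j \<in> F" "sum x F \<noteq> 0" "v (sum x F) = v (x j)"
    "\<forall>i\<in>F. v (x j) \<le> v (x i)"
    by auto
  have ne: "v (x a) \<noteq> v (x j)"
    using insert.prems(2) insert.hyps j(1) by (auto simp: inj_on_def)
  show ?case
  proof (cases "v (x a) < v (x j)")
    case True
    then show ?thesis
      using val_add_less[of "x a" "sum x F"] insert j by (intro bexI[of _ a]) force+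
  next
    case False
    then have "v (x j) < v (x a)" using ne by simp
    then show ?thesis
      using val_add_less[of "sum x F" "x a"] insert j
      by (intro bexI[of _ j]) (auto simp: add.commute)
  qed
qed

lemma ideal_pow_zero [simp]: "0 \<in> ideal_pow v i"
  by (simp add: ideal_pow_def)

lemma ideal_pow_add: "x \<in> ideal_pow v i \<Longrightarrow> y \<in> ideal_pow v i \<Longrightarrow> x + y \<in> ideal_pow v i"
  using val_add[of x y] by (fastforce simp: ideal_pow_def)

lemma ideal_pow_uminus_iff [simp]: "- x \<in> ideal_pow v i \<longleftrightarrow> x \<in> ideal_pow v i"
  by (simp add: ideal_pow_def)

lemma ideal_pow_diff: "x \<in> ideal_pow v i \<Longrightarrow> y \<in> ideal_pow v i \<Longrightarrow> x - y \<in> ideal_pow v i"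
  using ideal_pow_add[of x i "- y"] by simp

lemma ideal_pow_sum: "(\<And>j. j \<in> A \<Longrightarrow> x j \<in> ideal_pow v i) \<Longrightarrow> sum x A \<in> ideal_pow v i"
  by (induction A rule: infinite_finite_induct) (auto intro: ideal_pow_add)

lemma ideal_pow_mult:
  "x \<in> ideal_pow v i \<Longrightarrow> y \<in> ideal_pow v j \<Longrightarrow> x * y \<in> ideal_pow v (i + j)"
  by (cases "x = 0 \<or> y = 0") (auto simp: ideal_pow_def val_mult)

lemma ideal_pow_mono: "x \<in> ideal_pow v i \<Longrightarrow> j \<le> i \<Longrightarrow> x \<in> ideal_pow v j"
  by (auto simp: ideal_pow_def)

lemma ideal_pow_mult_left: "x \<in> ideal_pow v 0 \<Longrightarrow> y \<in> ideal_pow v i \<Longrightarrow> x * y \<in> ideal_pow v i"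
  using ideal_pow_mult[of x 0 y i] by simp

lemma ideal_pow_mult_right: "x \<in> ideal_pow v i \<Longrightarrow> y \<in> ideal_pow v 0 \<Longrightarrow> x * y \<in> ideal_pow v i"
  using ideal_pow_mult[of x i y 0] by simp

lemma one_in_ring [simp]: "1 \<in> ideal_pow v 0"
  by (simp add: ideal_pow_def)

lemma ring_power: "x \<in> ideal_pow v 0 \<Longrightarrow> x ^ k \<in> ideal_pow v 0"
  by (induction k) (auto intro: ideal_pow_mult_left)

lemma ideal_pow_power:
  assumes "x \<in> ideal_pow v i" "k > 0" shows "x ^ k \<in> ideal_pow v i"
proof -
  obtain m where "k = Suc m" using assms gr0_implies_Suc by blast
  then show ?thesis
    using assms ring_power[of x m] ideal_pow_mono[of x i 0] by (auto intro: ideal_pow_mult_right)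
qed

lemma ring_of_nat [simp]: "of_nat m \<in> ideal_pow v 0"
  by (induction m) (auto intro: ideal_pow_add)

lemma ideal_pow_of_nat_mult: "x \<in> ideal_pow v i \<Longrightarrow> of_nat m * x \<in> ideal_pow v i"
  by (rule ideal_pow_mult_left) auto

lemma ideal_pow_cong_iff: "x - y \<in> ideal_pow v i \<Longrightarrow> x \<in> ideal_pow v i \<longleftrightarrow> y \<in> ideal_pow v i"
  using ideal_pow_diff[of x i "x - y"] ideal_pow_add[of "x - y" i y] by auto

lemma unit_grp_iff: "u \<in> unit_grp v i \<longleftrightarrow> u - 1 \<in> ideal_pow v i"
  unfolding unit_grp_def by (auto intro: exI[of _ "u - 1"])

lemma principal_unit:
  assumes "u \<in> unit_grp v 1" shows "u \<noteq> 0 \<and> v u = 0"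
proof (cases "u = 1")
  case False
  then have "v (u - 1) \<ge> 1"
    using assms by (auto simp: unit_grp_iff ideal_pow_def)
  with False show ?thesis
    using val_add_less[of 1 "u - 1"] by simp
qed simp

text \<open>The middle binomial coefficients are divisible by \<open>p\<close> and the middle terms contain \<open>y\<close>; hence the
  error lies in \<open>ideal_pow v (N + j)\<close>.  The extra \<open>j\<close> is needed for \<open>x = 1\<close>, where the precision must
  exceed the valuation of \<open>p\<close>.\<close>

lemma frobenius_add:
  assumes p: "prime p" "of_nat p \<in> ideal_pow v N" and x: "x \<in> ideal_pow v 0" and y: "y \<in> ideal_pow v j"
  shows "(x + y) ^ p - (x ^ p + y ^ p) \<in> ideal_pow v (N + j)"
proof -
  have p0: "p > 0" using p(1) prime_gt_0_nat by blast
  have y0: "y \<in> ideal_pow v 0" using y ideal_pow_mono by blast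
  have "(x + y) ^ p = (\<Sum>k\<le>p. of_nat (p choose k) * x ^ k * y ^ (p - k))"
    by (rule binomial_ring)
  also have "{..p} = insert 0 (insert p {0<..<p})" using p0 by auto
  also have "(\<Sum>k\<in>insert 0 (insert p {0<..<p}). of_nat (p choose k) * x ^ k * y ^ (p - k))
      = y ^ p + (x ^ p + (\<Sum>k\<in>{0<..<p}. of_nat (p choose k) * x ^ k * y ^ (p - k)))"
    using p0 by (subst sum.insert; simp)+
  finally have "(x + y) ^ p - (x ^ p + y ^ p) = (\<Sum>k\<in>{0<..<p}. of_nat (p choose k) * x ^ k * y ^ (p - k))"
    by simp
  also have "\<dots> \<in> ideal_pow v (N + j)"
  proof (rule ideal_pow_sum)
    fix k assume k: "k \<in> {0<..<p}"
    then have "p dvd (p choose k)"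
      using p(1) by (intro dvd_choose_prime) auto
    then obtain c where "p choose k = p * c" by blast
    then have "of_nat (p choose k) \<in> ideal_pow v N"
      using p(2) by (auto intro: ideal_pow_mult_right)
    moreover have "y ^ (p - k) \<in> ideal_pow v j"
      using k y by (intro ideal_pow_power) auto
    ultimately show "of_nat (p choose k) * x ^ k * y ^ (p - k) \<in> ideal_pow v (N + j)"
      using ring_power[OF x] by (intro ideal_pow_mult ideal_pow_mult_right) auto
  qed
  finally show ?thesis .
qed

lemma frobenius_power_add:
  assumes p: "prime p" "of_nat p \<in> ideal_pow v N" and x: "x \<in> ideal_pow v 0" and y: "y \<in> ideal_pow v j"
  shows "(x + y) ^ (p ^ k) - (x ^ (p ^ k) + y ^ (p ^ k)) \<in> ideal_pow v (N + j)"
proof (induction k)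
  case (Suc k)
  have p0: "p > 0" using p(1) prime_gt_0_nat by blast
  define X Y where "X = x ^ (p ^ k)" and "Y = y ^ (p ^ k)"
  define r where "r = (x + y) ^ (p ^ k) - (X + Y)"
  have X: "X \<in> ideal_pow v 0" and Y: "Y \<in> ideal_pow v j"
    unfolding X_def Y_def using x y p0 by (auto intro: ring_power ideal_pow_power)
  have r: "r \<in> ideal_pow v (N + j)"
    using Suc by (simp add: r_def X_def Y_def)
  have Y0: "Y \<in> ideal_pow v 0" using Y ideal_pow_mono by blast
  have "(X + Y + r) ^ p - ((X + Y) ^ p + r ^ p) \<in> ideal_pow v (N + (N + j))"
    using p r X Y0 by (intro frobenius_add ideal_pow_add)
  then have 1: "(X + Y + r) ^ p - ((X + Y) ^ p + r ^ p) \<in> ideal_pow v (N + j)"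
    by (rule ideal_pow_mono) simp
  have 2: "r ^ p \<in> ideal_pow v (N + j)"
    using r p0 by (rule ideal_pow_power)
  have 3: "(X + Y) ^ p - (X ^ p + Y ^ p) \<in> ideal_pow v (N + j)"
    using p X Y by (rule frobenius_add)
  have "(X + Y + r) ^ p - (X ^ p + Y ^ p) \<in> ideal_pow v (N + j)"
    using ideal_pow_add[OF ideal_pow_add[OF 1 2] 3] by (simp add: algebra_simps)
  moreover have "(x + y) ^ (p ^ Suc k) = (X + Y + r) ^ p"
    unfolding r_def by (simp add: mult.commute[of p] power_mult)
  moreover have "x ^ (p ^ Suc k) = X ^ p" "y ^ (p ^ Suc k) = Y ^ p"
    by (simp_all add: X_def Y_def mult.commute[of p] power_mult)
  ultimately show ?case by simp
qed auto

text \<open>Modulo \<open>p\<close> the difference of the powers is the power of the difference.\<close>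

lemma frobenius_power_inject:
  assumes p: "prime p" "of_nat p \<in> ideal_pow v 1" and x: "x \<in> ideal_pow v 0" and y: "y \<in> ideal_pow v 0"
    and "x ^ (p ^ k) - y ^ (p ^ k) \<in> ideal_pow v 1"
  shows "x - y \<in> ideal_pow v 1"
proof (rule ccontr)
  assume "x - y \<notin> ideal_pow v 1"
  moreover have "x - y \<in> ideal_pow v 0" using x y by (rule ideal_pow_diff)
  ultimately have xy: "x - y \<noteq> 0" "v (x - y) = 0"
    by (auto simp: ideal_pow_def)
  have "(y + (x - y)) ^ (p ^ k) - (y ^ (p ^ k) + (x - y) ^ (p ^ k)) \<in> ideal_pow v (1 + 0)"
    using p x y by (intro frobenius_power_add ideal_pow_diff)
  then have "(x - y) ^ (p ^ k) \<in> ideal_pow v 1"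
    using ideal_pow_diff[OF assms(5)] by fastforce
  with xy show False
    by (auto simp: ideal_pow_def val_power)
qed

text \<open>A compact neighbourhood of 0 contains a multiple \<open>x0\<close> of the valuation ring, though not
  necessarily the ring itself, and finitely many cosets of the next smaller ideal cover it.\<close>

lemma finite_residue_cosets:
  "\<exists>F x0. finite F \<and> x0 \<noteq> 0 \<and> v x0 \<ge> 0 \<and>
    (\<forall>b\<in>ideal_pow v 0. \<exists>f\<in>F. x0 * b - f \<in> ideal_pow v (Suc (nat (v x0))))"
proof -
  let ?X = "valuation_topology v"
  have op: "openin ?X {y. y - x \<in> ideal_pow v i}" for x i
    unfolding openin_valuation_topology
  proof
    fix z assume "z \<in> {y. y - x \<in> ideal_pow v i}"
    then have "(\<lambda>y. z + y) ` ideal_pow v i \<subseteq> {y. y - x \<in> ideal_pow v i}"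
      using ideal_pow_add[of "z - x" i] by (auto simp: algebra_simps)
    then show "\<exists>i'. (\<lambda>y. z + y) ` ideal_pow v i' \<subseteq> {y. y - x \<in> ideal_pow v i}" by blast
  qed
  have "openin ?X UNIV" by (auto simp: openin_valuation_topology)
  then have "(0::'a) \<in> topspace ?X" using openin_subset by blast
  then obtain U C where UC: "openin ?X U" "compactin ?X C" "0 \<in> U" "U \<subseteq> C"
    using locally_compact unfolding locally_compact_space_def by blast
  then obtain i where i: "ideal_pow v i \<subseteq> C"
    unfolding openin_valuation_topology by fastforce
  define W where "W x = {y. y - x \<in> ideal_pow v (Suc i)}" for x
  have "\<forall>S\<in>range W. openin ?X S" using op by (auto simp: W_def)
  moreover have "C \<subseteq> \<Union>(range W)"
  proof
    fix c assume "c \<in> C"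
    have "c \<in> W c" by (simp add: W_def)
    then show "c \<in> \<Union>(range W)" by blast
  qed
  ultimately obtain \<F> where F: "finite \<F>" "\<F> \<subseteq> range W" "C \<subseteq> \<Union>\<F>"
    using UC(2) unfolding compactin_def by meson
  obtain F where F': "finite F" "\<F> = W ` F"
    using F(1,2) finite_subset_image by metis
  obtain t where t: "t \<noteq> 0" "v t = 1" using val_normalized by blast
  have vt: "v (t ^ i) = int i" using t by (simp add: val_power)
  have "\<exists>f\<in>F. t ^ i * b - f \<in> ideal_pow v (Suc (nat (v (t ^ i))))"
    if "b \<in> ideal_pow v 0" for b
  proof -
    have "t ^ i \<in> ideal_pow v i" using vt by (simp add: ideal_pow_def)
    then have "t ^ i * b \<in> C"
      using that i by (auto intro: ideal_pow_mult_right)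
    then show ?thesis
      using F(3) F'(2) vt by (auto simp: W_def)
  qed
  then show ?thesis
    using t vt F'(1) by (intro exI[of _ F] exI[of _ "t ^ i"]) auto
qed

text \<open>The \<open>p\<close>-power iterates of an integral element meet only finitely many residue classes, so two
  of them agree; injectivity of Frobenius then writes the residue of the element as a power.\<close>

lemma residue_field_perfect:
  assumes p: "prime p" "of_nat p \<in> ideal_pow v 1" and b: "b \<in> ideal_pow v 0"
  shows "\<exists>t\<in>ideal_pow v 0. b - t ^ p \<in> ideal_pow v 1"
proof -
  obtain F x0 where F: "finite F" "x0 \<noteq> 0"
    "\<And>b. b \<in> ideal_pow v 0 \<Longrightarrow> \<exists>f\<in>F. x0 * b - f \<in> ideal_pow v (Suc (nat (v x0)))"
    and vx0: "v x0 \<ge> 0"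
    using finite_residue_cosets by blast
  define c where "c j = (SOME f. f \<in> F \<and> x0 * b ^ (p ^ j) - f \<in> ideal_pow v (Suc (nat (v x0))))" for j :: nat
  have c: "c j \<in> F \<and> x0 * b ^ (p ^ j) - c j \<in> ideal_pow v (Suc (nat (v x0)))" for j
    unfolding c_def
    by (rule someI_ex) (use F(3)[of "b ^ (p ^ j)"] ring_power[OF b] in blast)
  have "\<not> inj c"
    using F(1) c by (metis finite_subset image_subsetI infinite_UNIV_nat finite_imageD)
  then obtain j d where jd: "c j = c (j + Suc d)"
    unfolding inj_def by (metis less_iff_Suc_add linorder_neqE_nat add_Suc_right)
  have "x0 * b ^ (p ^ j) - x0 * b ^ (p ^ (j + Suc d)) \<in> ideal_pow v (Suc (nat (v x0)))"
    using ideal_pow_diff[of "x0 * b ^ (p ^ j) - c j" _ "x0 * b ^ (p ^ (j + Suc d)) - c (j + Suc d)"]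
      c[of j] c[of "j + Suc d"] jd by simp
  then have "x0 * (b ^ (p ^ j) - b ^ (p ^ (j + Suc d))) \<in> ideal_pow v (Suc (nat (v x0)))"
    by (simp add: algebra_simps)
  then have "b ^ (p ^ j) - b ^ (p ^ (j + Suc d)) \<in> ideal_pow v 1"
    using F(2) vx0 val_mult[of x0 "b ^ (p ^ j) - b ^ (p ^ (j + Suc d))"]
    by (cases "b ^ (p ^ j) - b ^ (p ^ (j + Suc d)) = 0") (simp_all add: ideal_pow_def)
  moreover have "b ^ (p ^ (j + Suc d)) = (b ^ (p ^ Suc d)) ^ (p ^ j)"
    by (metis power_add power_mult mult.commute)
  ultimately have "b - b ^ (p ^ Suc d) \<in> ideal_pow v 1"
    using frobenius_power_inject[OF p b ring_power[OF b]] by simp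
  moreover have "b ^ (p ^ Suc d) = (b ^ (p ^ d)) ^ p"
    by (metis power_Suc power_mult mult.commute)
  ultimately show ?thesis
    using ring_power[OF b] by metis
qed

text \<open>Iterating the previous lemma is legitimate because congruent elements have congruent \<open>p\<close>-th powers.\<close>

lemma residue_field_perfect_power:
  assumes p: "prime p" "of_nat p \<in> ideal_pow v 1" and b: "b \<in> ideal_pow v 0"
  shows "\<exists>t\<in>ideal_pow v 0. b - t ^ (p ^ k) \<in> ideal_pow v 1"
  using b
proof (induction k arbitrary: b)
  case 0
  then show ?case by (auto intro!: bexI[of _ b])
next
  case (Suc k)
  then obtain s where s: "s \<in> ideal_pow v 0" "b - s ^ p \<in> ideal_pow v 1"
    using residue_field_perfect p by blast
  obtain t where t: "t \<in> ideal_pow v 0" "s - t ^ (p ^ k) \<in> ideal_pow v 1"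
    using Suc.IH s by blast
  define r where "r = s - t ^ (p ^ k)"
  have "(t ^ (p ^ k) + r) ^ p - ((t ^ (p ^ k)) ^ p + r ^ p) \<in> ideal_pow v (1 + 0)"
    using p t ring_power[OF t(1)] ideal_pow_mono[OF t(2), of 0]
    by (intro frobenius_add) (auto simp: r_def)
  moreover have "r ^ p \<in> ideal_pow v 1"
    using t p(1) by (intro ideal_pow_power) (auto simp: r_def prime_gt_0_nat)
  ultimately have "s ^ p - (t ^ (p ^ k)) ^ p \<in> ideal_pow v 1"
    using ideal_pow_add[of "s ^ p - ((t ^ (p ^ k)) ^ p + r ^ p)" 1 "r ^ p"] by (simp add: r_def)
  from ideal_pow_add[OF s(2) this] have "b - t ^ (p ^ Suc k) \<in> ideal_pow v 1"
    by (simp add: power_mult[symmetric] mult.commute)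
  then show ?case using t(1) by blast
qed

text \<open>Bezout: a positive valuation of \<open>m\<close> and of \<open>p\<close> would give one of \<open>1\<close>.\<close>

lemma val_of_nat_coprime:
  assumes p: "prime p" "of_nat p \<in> ideal_pow v 1" and m: "\<not> p dvd m"
  shows "of_nat m \<noteq> (0::'a) \<and> v (of_nat m) = 0"
proof -
  have "of_nat m \<notin> ideal_pow v 1"
  proof
    assume mi: "of_nat m \<in> ideal_pow v 1"
    have "coprime m p" using p m by (metis coprime_commute prime_imp_coprime)
    moreover have "m \<noteq> 0" using m by (metis dvd_0_right)
    ultimately obtain x y where "m * x = p * y + 1"
      using bezout_nat[of m p] by auto
    then have "(1::'a) = of_nat x * of_nat m - of_nat y * of_nat p"
      by (metis add_diff_cancel_left' mult.commute of_nat_1 of_nat_add of_nat_mult)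
    also have "\<dots> \<in> ideal_pow v 1"
      using mi p by (intro ideal_pow_diff ideal_pow_of_nat_mult)
    finally show False by (simp add: ideal_pow_def)
  qed
  then show ?thesis
    using ring_of_nat[of m] by (auto simp: ideal_pow_def simp del: ring_of_nat)
qed

end

section \<open>Power bases of totally ramified extensions\<close>

text \<open>The criterion is stated for indexed families because it then also gives the injectivity that is
  needed to count the basis vectors.\<close>

lemma (in vector_space) independent_family:
  assumes "finite A" and ind: "\<And>c. (\<Sum>i\<in>A. scale (c i) (b i)) = 0 \<Longrightarrow> \<forall>i\<in>A. c i = 0"
  shows "inj_on b A" and "independent (b ` A)"
proof -
  show inj: "inj_on b A"
  proof (rule inj_onI, rule ccontr)
    fix i j assume ij: "i \<in> A" "j \<in> A" "b i = b j" "i \<noteq> j"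
    define c where "c k = (if k = i then 1 else 0) - (if k = j then 1 else (0::'a))" for k
    have *: "scale (c k) (b k) = (if k = i then b k else 0) - (if k = j then b k else 0)" for k
      by (simp add: c_def scale_left_diff_distrib)
    have "(\<Sum>k\<in>A. scale (c k) (b k)) = b i - b j"
      unfolding * sum_subtractf using ij assms(1) by (simp add: sum.delta)
    then have "c i = 0" using ind[of c] ij by simp
    then show False using ij by (simp add: c_def)
  qed
  show "independent (b ` A)"
  proof
    assume "dependent (b ` A)"
    then obtain u x where u: "x \<in> b ` A" "u x \<noteq> 0" "(\<Sum>x\<in>b ` A. scale (u x) x) = 0"
      using dependent_finite[of "b ` A"] assms(1) by auto
    then have "(\<Sum>i\<in>A. scale (u (b i)) (b i)) = 0"
      using sum.reindex[OF inj, of "\<lambda>x. scale (u x) x"] by simp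
    with ind[of "\<lambda>i. u (b i)"] u show False by auto
  qed
qed

context local_field_extension
begin

sublocale E: vector_space "ext_scale \<iota>"
  by unfold_locales (auto simp: ext_scale_def hom_add hom_mult hom_one algebra_simps)

lemma hom_zero [simp]: "\<iota> 0 = 0"
  using hom_add[of 0 0] by (metis add.right_neutral add_left_imp_eq)

lemma hom_minus: "\<iota> (- x) = - \<iota> x"
  using hom_add[of x "- x"] by (simp add: eq_neg_iff_add_eq_0 add.commute)

lemma hom_diff: "\<iota> (x - y) = \<iota> x - \<iota> y"
  using hom_add[of x "- y"] by (simp add: hom_minus)

lemma hom_eq_0_iff [simp]: "\<iota> x = 0 \<longleftrightarrow> x = 0"
proof
  assume 0: "\<iota> x = 0"
  show "x = 0"
  proof (rule ccontr)
    assume "x \<noteq> 0"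
    then have "\<iota> 1 = \<iota> x * \<iota> (inverse x)" by (simp flip: hom_mult)
    with 0 show False by (simp add: hom_one)
  qed
qed simp

lemma hom_power: "\<iota> (x ^ k) = \<iota> x ^ k"
  by (induction k) (auto simp: hom_mult hom_one)

lemma hom_of_nat: "\<iota> (of_nat m) = of_nat m"
  by (induction m) (auto simp: hom_add hom_one)

definition eval_at :: "'l \<Rightarrow> 'k poly \<Rightarrow> 'l" where
  "eval_at x f = poly (map_poly \<iota> f) x"

lemma eval_at_pCons: "eval_at x (pCons a f) = \<iota> a + x * eval_at x f"
  by (simp add: eval_at_def map_poly_pCons)

lemma eval_at_0 [simp]: "eval_at x 0 = 0"
  by (simp add: eval_at_def)

lemma eval_at_add: "eval_at x (f + g) = eval_at x f + eval_at x g"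
proof -
  have "map_poly \<iota> (f + g) = map_poly \<iota> f + map_poly \<iota> g"
    by (rule poly_eqI) (simp add: coeff_map_poly hom_add)
  then show ?thesis by (simp add: eval_at_def)
qed

lemma eval_at_smult: "eval_at x (smult a f) = \<iota> a * eval_at x f"
  by (induction f) (auto simp: eval_at_pCons hom_mult algebra_simps)

lemma eval_at_mult: "eval_at x (f * g) = eval_at x f * eval_at x g"
  by (induction f) (auto simp: eval_at_pCons eval_at_add eval_at_smult algebra_simps)

lemma eval_at_sum: "eval_at x (sum f A) = (\<Sum>i\<in>A. eval_at x (f i))"
  by (induction A rule: infinite_finite_induct) (auto simp: eval_at_add)

lemma eval_at_altdef:
  assumes "degree f \<le> m" shows "eval_at x f = (\<Sum>i\<le>m. \<iota> (coeff f i) * x ^ i)"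
proof -
  have "degree (map_poly \<iota> f) = degree f"
    by (rule degree_map_poly) simp
  then have "eval_at x f = (\<Sum>i\<le>degree f. \<iota> (coeff f i) * x ^ i)"
    by (simp add: eval_at_def poly_altdef coeff_map_poly)
  also have "\<dots> = (\<Sum>i\<le>m. \<iota> (coeff f i) * x ^ i)"
    using assms by (intro sum.mono_neutral_left) (auto simp: not_le coeff_eq_0)
  finally show ?thesis .
qed

lemma eval_at_monom: "eval_at x (monom a i) = \<iota> a * x ^ i"
  by (induction i) (auto simp: monom_Suc monom_0 eval_at_pCons)

lemma presents_iff:
  "presents \<iota> g x \<longleftrightarrow> surj (eval_at x) \<and> (\<forall>f. eval_at x f = 0 \<longleftrightarrow> g dvd f)"
  by (simp add: presents_def eval_at_def[abs_def])

text \<open>By division with remainder, the powers of \<open>x\<close> with exponent below the degree of \<open>g\<close> form a basis.\<close>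

lemma presents_degree:
  assumes g: "degree g > 0" and pr: "presents \<iota> g x"
  shows "degree g = ext_degree \<iota>"
proof -
  let ?m = "degree g"
  have ind: "\<forall>i\<in>{..<?m}. c i = 0" if c: "(\<Sum>i\<in>{..<?m}. ext_scale \<iota> (c i) (x ^ i)) = 0" for c
  proof -
    define f where "f = (\<Sum>i\<in>{..<?m}. monom (c i) i)"
    have "eval_at x f = 0"
      using c by (simp add: f_def eval_at_sum eval_at_monom ext_scale_def)
    then have "g dvd f" using pr by (simp add: presents_iff)
    moreover have "degree f < ?m"
      unfolding f_def using g
      by (intro degree_sum_less) (auto intro: le_less_trans[OF degree_monom_le])
    ultimately have "f = 0" by (metis dvd_imp_degree_le not_le)
    have "coeff f i = c i" if "i < ?m" for i
      using that by (simp add: f_def coeff_sum sum.delta)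
    with \<open>f = 0\<close> show ?thesis by simp
  qed
  let ?C = "(\<lambda>i. x ^ i) ` {..<?m}"
  have inj: "inj_on (\<lambda>i. x ^ i) {..<?m}" and indC: "E.independent ?C"
    using E.independent_family[of "{..<?m}" "\<lambda>i. x ^ i", OF _ ind] by blast+
  have "y \<in> E.span ?C" for y
  proof -
    obtain f where f: "y = eval_at x f" using pr unfolding presents_iff surj_def by metis
    have "eval_at x g = 0" using pr by (simp add: presents_iff)
    then have "y = eval_at x (f mod g)"
      unfolding f by (subst div_mult_mod_eq[of f g, symmetric])
        (simp only: eval_at_add eval_at_mult, simp)
    also have "degree (f mod g) \<le> ?m - 1"
      using degree_mod_less'[of g f] g by (cases "f mod g = 0"; cases "g = 0") auto
    then have "eval_at x (f mod g) = (\<Sum>i\<le>?m - 1. ext_scale \<iota> (coeff (f mod g) i) (x ^ i))"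
      by (simp add: eval_at_altdef ext_scale_def)
    also have "\<dots> \<in> E.span ?C"
      using g by (intro E.span_sum E.span_scale E.span_base) auto
    finally show ?thesis .
  qed
  then have "UNIV \<subseteq> E.span ?C" by blast
  then have "E.dim UNIV = card ?C"
    using E.basis_card_eq_dim[of ?C UNIV] indC by simp
  then show ?thesis
    using card_image[OF inj] by (simp add: ext_degree_def)
qed

lemma finite_dimensional: "\<exists>B. finite_dimensional_vector_space (ext_scale \<iota>) B"
proof -
  obtain B where B: "E.independent B" "UNIV \<subseteq> E.span B" "card B = E.dim UNIV"
    by (rule E.basis_exists[of UNIV])
  then have "finite B"
    using finite_degree by (auto simp: ext_degree_def intro: card_ge_0_finite)
  moreover have "E.span B = UNIV" using B(2) by blast
  ultimately have "finite_dimensional_vector_space (ext_scale \<iota>) B"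
    using B(1) by unfold_locales
  then show ?thesis by (rule exI)
qed

lemma finite_independent: "E.independent B \<Longrightarrow> finite B"
  using finite_dimensional finite_dimensional_vector_space.finiteI_independent by blast

lemma independent_spanning:
  assumes "E.independent B" "card B = ext_degree \<iota>" shows "E.span B = UNIV"
proof -
  obtain B' where "finite_dimensional_vector_space (ext_scale \<iota>) B'"
    using finite_dimensional by blast
  then have "UNIV \<subseteq> E.span B"
    using finite_dimensional_vector_space.card_eq_dim[of "ext_scale \<iota>" B' B UNIV]
      assms finite_independent by (auto simp: ext_degree_def)
  then show ?thesis by blast
qed

end

text \<open>Only a uniformizer is fixed here, since its Eisenstein polynomial has still to be constructed.\<close>

locale uniformized_extension = local_field_extension vK vL \<iota>
  for vK :: "'k::field \<Rightarrow> int" and vL :: "'l::field \<Rightarrow> int" and \<iota> :: "'k \<Rightarrow> 'l" +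
  fixes n :: nat and \<pi> :: 'l
  assumes degree_eq: "n = ext_degree \<iota>"
    and ramified: "totally_ramified vK vL \<iota>"
    and uniformizer: "\<pi> \<noteq> 0" "vL \<pi> = 1"
begin

lemma n_pos: "n > 0"
  using finite_degree degree_eq by simp

lemma val_hom: "x \<noteq> 0 \<Longrightarrow> vL (\<iota> x) = int n * vK x"
  using ramified degree_eq by (simp add: totally_ramified_def)

lemma hom_ideal_pow: "x \<in> ideal_pow vK i \<Longrightarrow> \<iota> x \<in> ideal_pow vL (n * i)"
  using mult_left_mono[of "int i" "vK x" "int n"]
  by (cases "x = 0") (auto simp: ideal_pow_def val_hom)

lemma hom_ring: "x \<in> ideal_pow vK 0 \<Longrightarrow> \<iota> x \<in> ideal_pow vL 0"
  using hom_ideal_pow[of x 0] by simp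

lemma val_term: "c \<noteq> 0 \<Longrightarrow> vL (\<iota> c * \<pi> ^ i) = int n * vK c + int i"
  using uniformizer by (simp add: L.val_mult L.val_power val_hom)

text \<open>The valuations of the terms are distinct because they are distinct modulo \<open>n\<close>.\<close>

lemma val_expansion:
  assumes "finite A" "inj_on (\<lambda>i. i mod n) A" "\<exists>j\<in>A. c j \<noteq> 0"
  defines "s \<equiv> (\<Sum>i\<in>A. \<iota> (c i) * \<pi> ^ i)"
  shows "s \<noteq> 0 \<and> (\<exists>j\<in>A. c j \<noteq> 0 \<and> vL s = int n * vK (c j) + int j \<and>
    (\<forall>i\<in>A. c i \<noteq> 0 \<longrightarrow> int n * vK (c j) + int j \<le> int n * vK (c i) + int i))"
proof -
  define A' where "A' = {i\<in>A. c i \<noteq> 0}"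
  have s: "s = (\<Sum>i\<in>A'. \<iota> (c i) * \<pi> ^ i)"
    unfolding s_def A'_def using assms(1) by (intro sum.mono_neutral_right) auto
  have val: "vL (\<iota> (c i) * \<pi> ^ i) = int n * vK (c i) + int i" if "i \<in> A'" for i
    using that val_term by (simp add: A'_def)
  have "inj_on (\<lambda>i. vL (\<iota> (c i) * \<pi> ^ i)) A'"
  proof (rule inj_onI)
    fix i j assume ij: "i \<in> A'" "j \<in> A'" "vL (\<iota> (c i) * \<pi> ^ i) = vL (\<iota> (c j) * \<pi> ^ j)"
    then have "int n * vK (c i) + int i = int n * vK (c j) + int j"
      using val by simp
    then have "int i mod int n = int j mod int n"
      by (metis mod_mult_self4)
    then have "i mod n = j mod n"
      by (simp flip: zmod_int)
    then show "i = j"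
      using assms(2) ij by (auto simp: A'_def dest: inj_onD)
  qed
  then have "\<exists>j\<in>A'. s \<noteq> 0 \<and> vL s = vL (\<iota> (c j) * \<pi> ^ j) \<and>
      (\<forall>i\<in>A'. vL (\<iota> (c j) * \<pi> ^ j) \<le> vL (\<iota> (c i) * \<pi> ^ i))"
    unfolding s using assms(1,3) uniformizer
    by (intro L.val_sum_distinct) (auto simp: A'_def)
  then show ?thesis
    using val by (auto simp: A'_def)
qed

lemma inj_mod_lessThan: "inj_on (\<lambda>i. i mod n) {..<n}"
  by (auto intro!: inj_onI)

lemma inj_mod_atLeastAtMost: "inj_on (\<lambda>i. i mod n) {1..n}"
proof (rule inj_onI)
  fix i j assume ij: "i \<in> {1..n}" "j \<in> {1..n}" "i mod n = j mod n"
  then show "i = j"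
    by (cases "i = n"; cases "j = n") auto
qed

abbreviation powers :: "'l set" where
  "powers \<equiv> (\<lambda>i. \<pi> ^ i) ` {..<n}"

lemma power_basis:
  "inj_on (\<lambda>i. \<pi> ^ i) {..<n}" "E.independent powers" "E.span powers = UNIV"
proof -
  have ind: "\<forall>i\<in>{..<n}. c i = 0" if "(\<Sum>i\<in>{..<n}. ext_scale \<iota> (c i) (\<pi> ^ i)) = 0" for c
    using val_expansion[OF _ inj_mod_lessThan, of c] that by (auto simp: ext_scale_def)
  show inj: "inj_on (\<lambda>i. \<pi> ^ i) {..<n}" and "E.independent powers"
    using E.independent_family[of "{..<n}" "\<lambda>i. \<pi> ^ i", OF _ ind] by blast+
  then show "E.span powers = UNIV"
    using independent_spanning card_image[OF inj] degree_eq by simp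
qed

definition coord :: "'l \<Rightarrow> nat \<Rightarrow> 'k" where
  "coord x i = E.representation powers x (\<pi> ^ i)"

lemma expansion: "x = (\<Sum>i<n. \<iota> (coord x i) * \<pi> ^ i)"
proof -
  have "(\<Sum>b\<in>powers. ext_scale \<iota> (E.representation powers x b) b) = x"
    using power_basis by (intro E.sum_representation_eq) auto
  then show ?thesis
    using sum.reindex[OF power_basis(1), of "\<lambda>b. ext_scale \<iota> (E.representation powers x b) b"]
    by (simp add: coord_def ext_scale_def)
qed

lemma coord_add: "coord (x + y) i = coord x i + coord y i"
  using power_basis by (simp add: coord_def E.representation_add)

lemma coord_scale: "coord (\<iota> c * x) i = c * coord x i"
  using power_basis E.representation_scale[of powers x c] by (simp add: coord_def ext_scale_def)

lemma coord_zero [simp]: "coord 0 i = 0"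
  by (simp add: coord_def E.representation_zero)

lemma coord_sum: "coord (sum f A) i = (\<Sum>j\<in>A. coord (f j) i)"
  by (induction A rule: infinite_finite_induct) (auto simp: coord_add)

lemma coord_uminus: "coord (- x) i = - coord x i"
  using coord_scale[of "-1" x i] by (simp add: hom_minus hom_one)

lemma coord_power:
  assumes "i < n" "j < n" shows "coord (\<pi> ^ j) i = (if i = j then 1 else 0)"
proof -
  have "E.representation powers (\<pi> ^ j) = (\<lambda>b. if b = \<pi> ^ j then 1 else 0)"
    using power_basis(2) assms by (intro E.representation_basis) auto
  then show ?thesis
    using power_basis(1) assms by (auto simp: coord_def inj_on_def)
qed

text \<open>As the terms have distinct valuations, none of them can have a negative valuation if the sum is
  integral; and \<open>\<pi>\<^sup>i\<close> with \<open>i < n\<close> cannot make up for a pole of its coefficient.\<close>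

lemma coord_integral:
  assumes x: "x \<in> ideal_pow vL 0" and i: "i < n"
  shows "coord x i \<in> ideal_pow vK 0"
proof (cases "coord x i = 0")
  case False
  then obtain j where j: "j < n" "coord x j \<noteq> 0" "x \<noteq> 0" "vL x = int n * vK (coord x j) + int j"
    "int n * vK (coord x j) + int j \<le> int n * vK (coord x i) + int i"
    using val_expansion[OF _ inj_mod_lessThan, of "coord x"] i expansion[of x] by force
  then have "0 \<le> int n * vK (coord x i) + int i"
    using x by (auto simp: ideal_pow_def)
  then have "int n * (vK (coord x i) + 1) > 0"
    using i by (simp add: algebra_simps)
  then have "vK (coord x i) \<ge> 0"
    using n_pos by (simp add: zero_less_mult_iff)
  then show ?thesis by (simp add: ideal_pow_def)
qed simp

end

text \<open>The coefficients come from the expansion of \<open>\<pi>\<^sup>n\<close> in the power basis.  Since the valuations of the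
  terms are distinct, the smallest of them is \<open>n\<close>; only the constant term can attain it, with a
  coefficient of valuation 1, and the other coefficients lie in the maximal ideal.\<close>

lemma (in uniformized_extension) eisenstein_polynomial_exists:
  "\<exists>g. eisenstein vK g \<and> presents \<iota> g \<pi>"
proof -
  define c where "c i = (if i = n then - 1 else coord (\<pi> ^ n) i)" for i
  define g where "g = monom 1 n - (\<Sum>i<n. monom (c i) i)"
  have coeff_sum: "coeff (\<Sum>i<n. monom (c i) i) j = (if j < n then c j else 0)" for j
    by (simp add: coeff_sum sum.delta)
  have coeff: "coeff g j = (if j < n then - c j else if j = n then 1 else 0)" for j
    using coeff_sum[of j] by (auto simp: g_def)
  have deg: "degree g = n"
    using coeff by (intro antisym degree_le le_degree) auto
  have "eval_at \<pi> g = (\<Sum>i\<le>n. \<iota> (coeff g i) * \<pi> ^ i)"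
    using deg by (simp add: eval_at_altdef)
  also have "\<dots> = (\<Sum>i<n. \<iota> (- c i) * \<pi> ^ i) + \<pi> ^ n"
    by (simp add: coeff hom_one flip: lessThan_Suc_atMost)
  also have "(\<Sum>i<n. \<iota> (- c i) * \<pi> ^ i) = - (\<Sum>i<n. \<iota> (coord (\<pi> ^ n) i) * \<pi> ^ i)"
    by (simp add: c_def hom_minus sum_negf)
  also have "\<dots> = - (\<pi> ^ n)" using expansion[of "\<pi> ^ n"] by simp
  finally have root: "eval_at \<pi> g = 0" by simp
  have "\<exists>j<n. c j \<noteq> 0"
  proof (rule ccontr)
    assume "\<not> ?thesis"
    then have "\<pi> ^ n = 0" using expansion[of "\<pi> ^ n"] by (simp add: c_def)
    with uniformizer show False by simp
  qed
  moreover have "\<pi> ^ n = (\<Sum>i<n. \<iota> (c i) * \<pi> ^ i)"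
    using expansion[of "\<pi> ^ n"] by (simp add: c_def)
  ultimately obtain j where j: "j < n" "c j \<noteq> 0" "vL (\<pi> ^ n) = int n * vK (c j) + int j"
    "\<And>i. i < n \<Longrightarrow> c i \<noteq> 0 \<Longrightarrow> int n * vK (c j) + int j \<le> int n * vK (c i) + int i"
    using val_expansion[OF _ inj_mod_lessThan, of c] by auto
  have vn: "vL (\<pi> ^ n) = int n" using uniformizer by (simp add: L.val_power)
  have "int j mod int n = 0"
    using j(3) vn by (metis mod_mult_self4 mod_self)
  then have j0: "j = 0" using j(1) by simp
  then have vc0: "vK (c 0) = 1" "c 0 \<noteq> 0" using j vn n_pos by auto
  have vci: "vK (c i) \<ge> 1" if "i < n" "c i \<noteq> 0" for i
  proof -
    have "int n * vK (c i) > 0" using j(4)[OF that] vc0 j0 that by simp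
    then show ?thesis using n_pos by (simp add: zero_less_mult_iff)
  qed
  have eis: "eisenstein vK g"
    using vci vc0 n_pos by (auto simp: eisenstein_def deg coeff ideal_pow_def)
  have "g dvd f" if f: "eval_at \<pi> f = 0" for f
  proof -
    have "eval_at \<pi> f = eval_at \<pi> (f mod g)"
      by (subst div_mult_mod_eq[of f g, symmetric]) (simp only: eval_at_add eval_at_mult root, simp)
    moreover have "degree (f mod g) < n"
      using degree_mod_less'[of g f] deg n_pos by (cases "f mod g = 0"; cases "g = 0") auto
    then have "eval_at \<pi> (f mod g) = (\<Sum>i\<le>n - 1. \<iota> (coeff (f mod g) i) * \<pi> ^ i)"
      by (intro eval_at_altdef) simp
    moreover have "{..n - 1} = {..<n}" using n_pos by auto
    ultimately have "(\<Sum>i<n. \<iota> (coeff (f mod g) i) * \<pi> ^ i) = 0"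
      using f by simp
    then have "\<forall>i<n. coeff (f mod g) i = 0"
      using val_expansion[OF _ inj_mod_lessThan, of "coeff (f mod g)"] by auto
    then have "f mod g = 0"
      using \<open>degree (f mod g) < n\<close> by (metis leading_coeff_0_iff)
    then show ?thesis by (simp add: mod_eq_0_iff_dvd)
  qed
  moreover have "eval_at \<pi> f = 0" if "g dvd f" for f
    using that root by (auto simp: eval_at_mult)
  moreover have "surj (eval_at \<pi>)"
  proof (rule surjI)
    fix x
    have "eval_at \<pi> (\<Sum>i<n. monom (coord x i) i) = (\<Sum>i<n. \<iota> (coord x i) * \<pi> ^ i)"
      by (simp add: eval_at_sum eval_at_monom)
    also have "\<dots> = x" by (rule expansion[symmetric])
    finally show "eval_at \<pi> (\<Sum>i<n. monom (coord x i) i) = x" .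
  qed
  ultimately have "presents \<iota> g \<pi>"
    unfolding presents_iff by blast
  with eis show ?thesis by blast
qed

locale eisenstein_extension = uniformized_extension vK vL \<iota> n \<pi>
  for vK :: "'k::field \<Rightarrow> int" and vL :: "'l::field \<Rightarrow> int" and \<iota> :: "'k \<Rightarrow> 'l"
    and n :: nat and \<pi> :: 'l +
  fixes g :: "'k poly"
  assumes eis: "eisenstein vK g" and degree_g: "degree g = n" and root: "eval_at \<pi> g = 0"

text \<open>What has to be shown is that the root has valuation 1.  If its valuation were not positive, the
  leading term of the equation would strictly dominate the others; if it is positive, only
  the constant term and the leading term can balance.\<close>

lemma (in local_field_extension) presented_eisenstein_extension:
  assumes ram: "totally_ramified vK vL \<iota>" and eis: "eisenstein vK g" and pr: "presents \<iota> g x"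
  shows "eisenstein_extension vK vL \<iota> (ext_degree \<iota>) x g"
proof -
  define n where "n = ext_degree \<iota>"
  have deg: "degree g = n"
    using presents_degree[OF _ pr] eis by (simp add: eisenstein_def n_def)
  have n: "n > 0" using eis deg by (auto simp: eisenstein_def)
  have root: "eval_at x g = 0" using pr by (simp add: presents_iff)
  have val_hom: "vL (\<iota> y) = int n * vK y" if "y \<noteq> 0" for y
    using ram that by (simp add: totally_ramified_def n_def)
  define a where "a = coeff g"
  have an: "a n = 1" using eis by (simp add: a_def eisenstein_def deg)
  have a0: "a 0 \<noteq> 0" "vK (a 0) = 1" and ai: "\<And>i. i < n \<Longrightarrow> a i \<noteq> 0 \<Longrightarrow> vK (a i) \<ge> 1"
    using eis deg n by (auto simp: a_def eisenstein_def ideal_pow_def)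
  have "{..n} = insert n (insert 0 {0<..<n})" using n by auto
  then have sum: "0 = x ^ n + (\<iota> (a 0) + (\<Sum>i\<in>{0<..<n}. \<iota> (a i) * x ^ i))"
    using root n an by (simp add: eval_at_altdef[of g n] deg a_def[symmetric] hom_one)
  have sumI: "\<iota> (a 0) + (\<Sum>i\<in>{0<..<n}. \<iota> (a i) * x ^ i) = - (x ^ n)"
    using sum by (metis add_eq_0_iff)
  have x0: "x \<noteq> 0"
  proof
    assume "x = 0"
    then have "\<iota> (a 0) = 0"
      using sum n by (simp add: power_0_left)
    with a0 show False by simp
  qed
  have vxi: "vL (\<iota> (a i) * x ^ i) = int n * vK (a i) + int i * vL x" if "a i \<noteq> 0" for i
    using that x0 by (simp add: L.val_mult L.val_power val_hom)
  have pos: "vL x > 0"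
  proof (rule ccontr)
    assume "\<not> vL x > 0"
    then have neg: "vL x \<le> 0" by simp
    define t where "t i = \<iota> (a i) * x ^ i / x ^ n" for i
    have ti: "t i \<in> ideal_pow vL 1" if "i < n" for i
    proof (cases "a i = 0")
      case False
      have "int n * vL x \<le> int i * vL x"
        using neg that by (intro mult_right_mono_neg) auto
      moreover have "int n * vK (a i) \<ge> int n"
        using ai[OF that False] mult_left_mono[of 1 "vK (a i)" "int n"] by simp
      ultimately have "vL (\<iota> (a i) * x ^ i) - vL (x ^ n) \<ge> 1"
        using n x0 unfolding vxi[OF False] L.val_power[OF x0] by linarith
      then show ?thesis
        using False x0 by (simp add: t_def ideal_pow_def L.val_divide)
    qed (simp add: t_def)
    have "t 0 + (\<Sum>i\<in>{0<..<n}. t i) = (\<iota> (a 0) + (\<Sum>i\<in>{0<..<n}. \<iota> (a i) * x ^ i)) / x ^ n"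
      by (simp add: t_def add_divide_distrib sum_divide_distrib)
    also have "\<dots> = - 1" using x0 by (simp add: sumI)
    finally have "- 1 \<in> ideal_pow vL 1"
      using n ti L.ideal_pow_add[OF ti L.ideal_pow_sum[of "{0<..<n}" t 1]] by (metis greaterThanLessThan_iff)
    then show False by (simp add: ideal_pow_def)
  qed
  have "(\<Sum>i\<in>{0<..<n}. \<iota> (a i) * x ^ i) \<in> ideal_pow vL (n + 1)"
  proof (rule L.ideal_pow_sum)
    fix i assume i: "i \<in> {0<..<n}"
    show "\<iota> (a i) * x ^ i \<in> ideal_pow vL (n + 1)"
    proof (cases "a i = 0")
      case False
      have "int n * vK (a i) \<ge> int n * 1"
        using ai i False by (intro mult_left_mono) auto
      moreover have "int i * vL x \<ge> 1 * 1"
        using i pos by (intro mult_mono) auto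
      ultimately show ?thesis
        using vxi[OF False] by (simp add: ideal_pow_def)
    qed simp
  qed
  moreover have "vL (\<iota> (a 0)) = int n" using a0 by (simp add: val_hom)
  ultimately have "vL (\<iota> (a 0) + (\<Sum>i\<in>{0<..<n}. \<iota> (a i) * x ^ i)) = int n"
    using a0 L.val_add_less[of "\<iota> (a 0)" "\<Sum>i\<in>{0<..<n}. \<iota> (a i) * x ^ i"]
    by (cases "(\<Sum>i\<in>{0<..<n}. \<iota> (a i) * x ^ i) = 0") (auto simp: ideal_pow_def)
  then have "int n * vL x = int n * 1"
    using x0 by (simp add: sumI L.val_power)
  then have "vL x = 1" using n by simp
  then show ?thesis
    by unfold_locales (use ram eis deg root x0 in \<open>auto simp: n_def\<close>)
qed

section \<open>The different\<close>

context eisenstein_extension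
begin

lemma coeff_n: "coeff g n = 1" and coeff_0: "coeff g 0 \<noteq> 0" "vK (coeff g 0) = 1"
  and coeff_less: "i < n \<Longrightarrow> coeff g i \<noteq> 0 \<Longrightarrow> vK (coeff g i) \<ge> 1"
  using eis degree_g n_pos by (auto simp: eisenstein_def ideal_pow_def)

lemma coeff_integral: "coeff g i \<in> ideal_pow vK 0"
proof (cases i n rule: linorder_cases)
  case less
  then show ?thesis using coeff_less[of i] by (cases "coeff g i = 0") (auto simp: ideal_pow_def)
next
  case greater
  then show ?thesis by (simp add: coeff_eq_0 degree_g)
qed (simp add: coeff_n)

lemma root_sum: "(\<Sum>i\<le>n. \<iota> (coeff g i) * \<pi> ^ i) = 0"
  using root degree_g by (simp add: eval_at_altdef[of g n])

text \<open>These are the coefficients of \<open>g(X)/(X - \<pi>)\<close>.\<close>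

definition dual :: "nat \<Rightarrow> 'l" where
  "dual j = (\<Sum>k\<in>{j<..n}. \<iota> (coeff g k) * \<pi> ^ (k - j - 1))"

text \<open>This is \<open>g'(\<pi>)\<close>.\<close>

definition deriv_root :: 'l where
  "deriv_root = (\<Sum>k\<in>{1..n}. of_nat k * \<iota> (coeff g k) * \<pi> ^ (k - 1))"

text \<open>Taking the top coordinate of a product is a \<open>K\<close>-bilinear form on \<open>L\<close>, for which the elements
  \<open>dual j\<close> are the dual basis of the powers of \<open>\<pi>\<close>.  For \<open>i > j\<close> the equation \<open>g(\<pi>) = 0\<close> replaces
  the upper part of \<open>g\<close> by the lower one, which keeps all exponents below \<open>n - 1\<close>.\<close>

lemma dual_pairing:
  assumes "i < n" "j < n"
  shows "coord (dual j * \<pi> ^ i) (n - 1) = (if i = j then 1 else 0)"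
proof (cases "i \<le> j")
  case True
  have "dual j * \<pi> ^ i = (\<Sum>k\<in>{j<..n}. \<iota> (coeff g k) * \<pi> ^ (k - j - 1 + i))"
    unfolding dual_def sum_distrib_right
    by (intro sum.cong refl) (simp only: power_add mult.assoc)
  then have "coord (dual j * \<pi> ^ i) (n - 1)
      = (\<Sum>k\<in>{j<..n}. coeff g k * coord (\<pi> ^ (k - j - 1 + i)) (n - 1))"
    by (simp add: coord_sum coord_scale)
  also have "\<dots> = (\<Sum>k\<in>{j<..n}. if k = n then (if i = j then 1 else 0) else 0)"
  proof (rule sum.cong, simp)
    fix k assume k: "k \<in> {j<..n}"
    then have *: "coord (\<pi> ^ (k - j - 1 + i)) (n - 1) = (if n - 1 = k - j - 1 + i then 1 else 0)"
      using True assms by (intro coord_power) auto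
    then show "coeff g k * coord (\<pi> ^ (k - j - 1 + i)) (n - 1)
        = (if k = n then (if i = j then 1 else 0) else 0)"
    proof (cases "k = n")
      case eq: True
      have "n - 1 = k - j - 1 + i \<longleftrightarrow> i = j" using eq True assms by linarith
      then show ?thesis using * eq coeff_n by simp
    next
      case False
      then have "k < n" "j < k" using k by auto
      then have "n - 1 \<noteq> k - j - 1 + i" using True by linarith
      then show ?thesis using * False by simp
    qed
  qed
  also have "\<dots> = (if i = j then 1 else 0)"
    using assms by (simp add: sum.delta)
  finally show ?thesis .
next
  case False
  have "(\<Sum>k\<le>n. \<iota> (coeff g k) * \<pi> ^ k)
      = (\<Sum>k\<le>j. \<iota> (coeff g k) * \<pi> ^ k) + (\<Sum>k\<in>{j<..n}. \<iota> (coeff g k) * \<pi> ^ k)"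
    using assms by (subst sum.union_disjoint[symmetric]) (auto intro!: sum.cong)
  then have tail: "(\<Sum>k\<in>{j<..n}. \<iota> (coeff g k) * \<pi> ^ k) = - (\<Sum>k\<le>j. \<iota> (coeff g k) * \<pi> ^ k)"
    using root_sum by (simp add: eq_neg_iff_add_eq_0 add.commute)
  have "dual j * \<pi> ^ i = (\<Sum>k\<in>{j<..n}. \<iota> (coeff g k) * \<pi> ^ k) * \<pi> ^ (i - j - 1)"
    unfolding dual_def sum_distrib_right
  proof (rule sum.cong, simp)
    fix k assume "k \<in> {j<..n}"
    then have "k - j - 1 + i = k + (i - j - 1)" using False by auto
    then show "\<iota> (coeff g k) * \<pi> ^ (k - j - 1) * \<pi> ^ i = \<iota> (coeff g k) * \<pi> ^ k * \<pi> ^ (i - j - 1)"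
      by (metis mult.assoc power_add)
  qed
  also have "\<dots> = - (\<Sum>k\<le>j. \<iota> (coeff g k) * \<pi> ^ (k + (i - j - 1)))"
    unfolding tail by (simp add: sum_distrib_right power_add mult.assoc)
  finally have "coord (dual j * \<pi> ^ i) (n - 1)
      = - (\<Sum>k\<le>j. coeff g k * coord (\<pi> ^ (k + (i - j - 1))) (n - 1))"
    by (simp add: coord_uminus coord_sum coord_scale)
  also have "(\<Sum>k\<le>j. coeff g k * coord (\<pi> ^ (k + (i - j - 1))) (n - 1)) = 0"
    using False assms by (intro sum.neutral) (auto simp: coord_power)
  finally show ?thesis using False by simp
qed

lemma coord_dual:
  assumes "j < n" shows "coord (dual j * z) (n - 1) = coord z j"
proof -
  have "dual j * z = (\<Sum>i<n. \<iota> (coord z i) * (dual j * \<pi> ^ i))"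
    by (subst expansion[of z]) (simp add: sum_distrib_left algebra_simps)
  then have "coord (dual j * z) (n - 1) = (\<Sum>i<n. coord z i * coord (dual j * \<pi> ^ i) (n - 1))"
    by (simp add: coord_sum coord_scale)
  also have "\<dots> = (\<Sum>i<n. if i = j then coord z i else 0)"
    using assms by (intro sum.cong) (auto simp: dual_pairing simp del: One_nat_def)
  also have "\<dots> = coord z j" using assms by (simp add: sum.delta)
  finally show ?thesis .
qed

text \<open>The polynomial \<open>g(X)/(X - \<pi>)\<close> has the value \<open>g'(\<pi>)\<close> at \<open>\<pi>\<close>.\<close>

lemma sum_dual: "(\<Sum>j<n. dual j * \<pi> ^ j) = deriv_root"
proof -
  have "dual j * \<pi> ^ j = (\<Sum>k | k \<in> {1..n} \<and> j < k. \<iota> (coeff g k) * \<pi> ^ (k - 1))" for j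
    unfolding dual_def sum_distrib_right
    by (rule sum.cong) (auto simp: mult.assoc simp flip: power_add)
  then have "(\<Sum>j<n. dual j * \<pi> ^ j)
      = (\<Sum>j<n. \<Sum>k | k \<in> {1..n} \<and> j < k. \<iota> (coeff g k) * \<pi> ^ (k - 1))"
    by simp
  also have "\<dots> = (\<Sum>k\<in>{1..n}. \<Sum>j | j \<in> {..<n} \<and> j < k. \<iota> (coeff g k) * \<pi> ^ (k - 1))"
    by (rule sum.swap_restrict) auto
  also have "\<dots> = deriv_root"
    unfolding deriv_root_def
  proof (rule sum.cong, simp)
    fix k assume "k \<in> {1..n}"
    then have "{j. j \<in> {..<n} \<and> j < k} = {..<k}" by auto
    then show "(\<Sum>j | j \<in> {..<n} \<and> j < k. \<iota> (coeff g k) * \<pi> ^ (k - 1))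
        = of_nat k * \<iota> (coeff g k) * \<pi> ^ (k - 1)"
      by (simp add: mult.assoc)
  qed
  finally show ?thesis .
qed

text \<open>The definition of the trace quantifies over all bases, so the value has to be independent of \<open>B\<close>:
  expand the elements of \<open>B\<close> in powers of \<open>\<pi>\<close> and exchange the two sums.\<close>

lemma trace_in_basis:
  assumes B: "E.independent B" "E.span B = UNIV"
  shows "(\<Sum>b\<in>B. E.representation B (x * b) b) = (\<Sum>j<n. coord (x * \<pi> ^ j) j)"
proof -
  have fin: "finite B" using B(1) by (rule finite_independent)
  have rep: "E.representation B (x * b) c
      = (\<Sum>i<n. coord b i * E.representation B (x * \<pi> ^ i) c)" for b c
  proof -
    have "x * b = (\<Sum>i<n. ext_scale \<iota> (coord b i) (x * \<pi> ^ i))"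
      by (subst expansion[of b]) (simp add: sum_distrib_left ext_scale_def algebra_simps)
    then show ?thesis
      using B by (simp add: E.representation_sum E.representation_scale)
  qed
  have "(\<Sum>b\<in>B. E.representation B (x * b) b)
      = (\<Sum>i<n. \<Sum>b\<in>B. coord b i * E.representation B (x * \<pi> ^ i) b)"
    by (subst sum.swap) (intro sum.cong refl rep)
  also have "\<dots> = (\<Sum>i<n. coord (x * \<pi> ^ i) i)"
  proof (rule sum.cong, simp)
    fix i
    have "x * \<pi> ^ i = (\<Sum>b\<in>B. ext_scale \<iota> (E.representation B (x * \<pi> ^ i) b) b)"
      using B fin by (intro E.sum_representation_eq[symmetric]) auto
    then have "coord (x * \<pi> ^ i) i = (\<Sum>b\<in>B. E.representation B (x * \<pi> ^ i) b * coord b i)"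
      by (metis (no_types, lifting) coord_sum coord_scale ext_scale_def sum.cong)
    then show "(\<Sum>b\<in>B. coord b i * E.representation B (x * \<pi> ^ i) b) = coord (x * \<pi> ^ i) i"
      by (simp add: mult.commute)
  qed
  finally show ?thesis .
qed

text \<open>Euler's formula: the \<open>j\<close>-th coordinate of \<open>x \<pi>\<^sup>j\<close> is the top coordinate of \<open>dual j x \<pi>\<^sup>j\<close>, and these
  products add up to \<open>x g'(\<pi>)\<close>.\<close>

lemma trace_eq: "ext_trace \<iota> x = coord (x * deriv_root) (n - 1)"
proof -
  have "(\<Sum>j<n. coord (x * \<pi> ^ j) j) = (\<Sum>j<n. coord (dual j * (x * \<pi> ^ j)) (n - 1))"
    by (simp add: coord_dual del: One_nat_def)
  also have "\<dots> = coord (x * deriv_root) (n - 1)"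
    by (simp add: sum_dual[symmetric] coord_sum[symmetric] sum_distrib_left algebra_simps)
  finally have *: "(\<Sum>b\<in>B. E.representation B (x * b) b) = coord (x * deriv_root) (n - 1)"
    if "E.independent B" "E.span B = UNIV" for B
    using trace_in_basis[OF that] by simp
  show ?thesis
    unfolding ext_trace_def
    by (rule the_equality) (use * power_basis in auto)
qed

text \<open>If no such index existed, every term of \<open>g'(\<pi>)\<close> would be divisible by \<open>p\<close>.  Then Euler's formula
  puts \<open>1/p\<close> into the codifferent, and all of \<open>L\<close> if \<open>p = 0\<close>, so that the different would be
  too small.\<close>

lemma strongly_separable_index:
  assumes sep: "strongly_separable p vK vL \<iota>"
  shows "\<exists>i\<in>{1..n}. coeff g i \<noteq> 0 \<and> \<not> p dvd i \<and>
    enat (nat (vK (coeff g i)) * n + i) \<le> enat_val vL (of_nat p)"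
proof (rule ccontr)
  assume neg: "\<not> ?thesis"
  let ?t = "\<lambda>k. of_nat k * \<iota> (coeff g k) * \<pi> ^ (k - 1)"
  have \<pi>: "\<pi> ^ m \<in> ideal_pow vL 0" for m
    using uniformizer by (intro L.ring_power) (simp add: ideal_pow_def)
  have "\<exists>h\<in>ideal_pow vL 0. ?t k = of_nat p * h" if k: "k \<in> {1..n}" for k
  proof (cases "coeff g k = 0 \<or> p dvd k")
    case True
    then show ?thesis
    proof
      assume "p dvd k"
      then obtain m where "k = p * m" by blast
      then show ?thesis
        using \<pi> hom_ring[OF coeff_integral[of k]]
        by (intro bexI[of _ "of_nat m * \<iota> (coeff g k) * \<pi> ^ (k - 1)"])
          (auto intro!: L.ideal_pow_mult_left simp: mult.assoc)
    qed (auto intro!: bexI[of _ 0])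
  next
    case False
    then have "enat_val vL (of_nat p) < enat (nat (vK (coeff g k)) * n + k)"
      using neg k by auto
    then have p0: "of_nat p \<noteq> (0::'l)" and "nat (vL (of_nat p)) < nat (vK (coeff g k)) * n + k"
      by (auto simp: enat_val_def split: if_splits)
    then have "int (nat (vL (of_nat p))) < int (nat (vK (coeff g k)) * n + k)"
      by (simp only: of_nat_less_iff)
    moreover have "vK (coeff g k) \<ge> 0"
      using False coeff_integral[of k] by (auto simp: ideal_pow_def)
    moreover have "vL (of_nat p) \<ge> 0"
      using p0 L.ring_of_nat[of p] by (simp add: ideal_pow_def del: L.ring_of_nat)
    ultimately have "vL (of_nat p) \<le> vL (\<iota> (coeff g k) * \<pi> ^ (k - 1))"
      using False k by (simp add: val_term mult.commute)
    then have "\<iota> (coeff g k) * \<pi> ^ (k - 1) / of_nat p \<in> ideal_pow vL 0"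
      using p0 False uniformizer by (simp add: ideal_pow_def L.val_divide)
    then have "of_nat k * (\<iota> (coeff g k) * \<pi> ^ (k - 1) / of_nat p) \<in> ideal_pow vL 0"
      by (rule L.ideal_pow_of_nat_mult)
    then show ?thesis
      using p0 by (intro bexI) (auto simp: mult.assoc)
  qed
  then obtain H where H: "\<And>k. k \<in> {1..n} \<Longrightarrow> H k \<in> ideal_pow vL 0 \<and> ?t k = of_nat p * H k"
    by metis
  define h where "h = (\<Sum>k\<in>{1..n}. H k)"
  have h: "h \<in> ideal_pow vL 0" unfolding h_def using H by (intro L.ideal_pow_sum) auto
  have d: "deriv_root = of_nat p * h"
    unfolding deriv_root_def h_def sum_distrib_left using H by (intro sum.cong) auto
  obtain x where x: "x \<in> different_ideal vK vL \<iota>" "enat_val vL x < enat_val vL (of_nat p)"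
    using sep by (auto simp: strongly_separable_def INF_less_iff)
  then have x0: "x \<noteq> 0" by (auto simp: enat_val_def)
  \<comment> \<open>If \<open>p = 0\<close>, then \<open>d\<close> makes the trace vanish, and \<open>y\<close> may be any element with \<open>x y\<close> non-integral.\<close>
  define y where "y = (if of_nat p = (0::'l) then inverse (x * \<pi>) else inverse (of_nat p))"
  have "y \<in> codifferent vK vL \<iota>"
    unfolding codifferent_def
  proof (intro CollectI ballI)
    fix z assume z: "z \<in> ideal_pow vL 0"
    have "y * z * deriv_root = (if of_nat p = (0::'l) then 0 else z * h)"
      by (simp add: d y_def)
    also have "\<dots> \<in> ideal_pow vL 0" using z h by (auto intro: L.ideal_pow_mult_left)
    finally show "ext_trace \<iota> (y * z) \<in> ideal_pow vK 0"
      unfolding trace_eq using n_pos by (intro coord_integral) auto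
  qed
  then have xy: "x * y \<in> ideal_pow vL 0"
    using x(1) by (auto simp: different_ideal_def)
  show False
  proof (cases "of_nat p = (0::'l)")
    case True
    then have "x * y = inverse \<pi>" using x0 by (simp add: y_def)
    then show False
      using xy uniformizer by (simp add: ideal_pow_def L.val_inverse)
  next
    case False
    then have "x * y = x / of_nat p" by (simp add: y_def divide_inverse)
    then have "vL (of_nat p) \<le> vL x"
      using xy x0 False by (simp add: ideal_pow_def L.val_divide)
    then show False
      using x(2) x0 False by (simp add: enat_val_def nat_less_eq_zless)
  qed
qed

end

section \<open>The combinatorics of jump sets\<close>

lemma shift_rho_small:
  assumes "enat (p * i) \<le> e" shows "shift_rho e p i = p * i"
proof -
  have "enat (p * i) \<le> enat i + e" using assms by (cases e) auto
  then show ?thesis by (simp add: shift_rho_def min_def)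
qed

lemma shift_rho_funpow_small:
  assumes "enat (p ^ k * i) \<le> e" "p > 0" shows "(shift_rho e p ^^ k) i = p ^ k * i"
  using assms(1)
proof (induction k)
  case (Suc k)
  have "p ^ k * i \<le> p ^ Suc k * i"
    using assms(2) by simp
  then have "enat (p ^ k * i) \<le> e" using Suc.prems by (meson enat_ord_simps(1) order_trans)
  then show ?case
    using Suc by (simp add: shift_rho_small mult.assoc)
qed simp

lemma strict_mono_shift_rho:
  assumes "p > 0" shows "strict_mono (shift_rho e p)"
proof (rule strict_monoI)
  fix i j :: nat assume "i < j"
  moreover have "p * i < p * j" using \<open>i < j\<close> assms by simp
  ultimately show "shift_rho e p i < shift_rho e p j"
    by (cases e) (simp_all add: shift_rho_def min_less_iff_disj)
qed

lemma strict_mono_funpow: "strict_mono (f :: 'a::order \<Rightarrow> 'a) \<Longrightarrow> strict_mono (f ^^ k)"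
  by (induction k) (auto simp: strict_mono_def)

lemma jump_set_eqI:
  assumes J: "jump_set \<rho> (I, \<beta>)" and J': "jump_set \<rho>' (I', \<beta>')"
    and graph: "(\<lambda>i. (i, \<beta> i)) ` I = (\<lambda>i. (i, \<beta>' i)) ` I'"
  shows "(I, \<beta>) = (I', \<beta>')"
proof -
  have "I = fst ` (\<lambda>i. (i, \<beta> i)) ` I" by (simp add: image_image)
  also have "\<dots> = I'" unfolding graph by (simp add: image_image)
  finally have I: "I = I'" .
  have "\<beta> i = \<beta>' i" if "i \<in> I" for i
  proof -
    have "(i, \<beta> i) \<in> (\<lambda>i. (i, \<beta>' i)) ` I'"
      using that graph by blast
    then show ?thesis by auto
  qed
  then have "\<beta> = \<beta>'"
    using J J' I by (intro extensionalityI[of _ I]) (auto simp: jump_set_def PiE_def)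
  with I show ?thesis by simp
qed

text \<open>The breaks of \<open>w\<close> are the numbers \<open>\<beta> i - 1\<close>, and as \<open>\<rho>\<close> is injective the value of \<open>w\<close> behind
  a break recovers \<open>i\<close>.\<close>

lemma jump_set_of_weight_unique:
  assumes \<rho>: "strict_mono \<rho>"
    and J: "jump_set \<rho> (I, \<beta>)" and J': "jump_set \<rho> (I', \<beta>')"
    and b: "\<forall>k. w k \<noteq> w (k + 1) \<longleftrightarrow> k \<in> (\<lambda>i. \<beta> i - 1) ` I"
    and b': "\<forall>k. w k \<noteq> w (k + 1) \<longleftrightarrow> k \<in> (\<lambda>i. \<beta>' i - 1) ` I'"
    and v: "\<forall>i\<in>I. w (\<beta> i) = enat ((\<rho> ^^ (\<beta> i - 1)) i)"
    and v': "\<forall>i\<in>I'. w (\<beta>' i) = enat ((\<rho> ^^ (\<beta>' i - 1)) i)"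
  shows "(I, \<beta>) = (I', \<beta>')"
proof (rule jump_set_eqI[OF J J'])
  have sub: "(\<lambda>i. (i, \<gamma> i)) ` A \<subseteq> (\<lambda>i. (i, \<gamma>' i)) ` A'"
    if A: "jump_set \<rho> (A, \<gamma>)" and A': "jump_set \<rho> (A', \<gamma>')"
      and eq: "(\<lambda>i. \<gamma> i - 1) ` A = (\<lambda>i. \<gamma>' i - 1) ` A'"
      and v: "\<forall>i\<in>A. w (\<gamma> i) = enat ((\<rho> ^^ (\<gamma> i - 1)) i)"
      and v': "\<forall>i\<in>A'. w (\<gamma>' i) = enat ((\<rho> ^^ (\<gamma>' i - 1)) i)" for A \<gamma> A' \<gamma>'
  proof
    fix x assume "x \<in> (\<lambda>i. (i, \<gamma> i)) ` A"
    then obtain i where i: "i \<in> A" "x = (i, \<gamma> i)" by blast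
    then obtain j where j: "j \<in> A'" "\<gamma> i - 1 = \<gamma>' j - 1" using eq by blast
    have "\<gamma> i \<ge> 1" "\<gamma>' j \<ge> 1" using A A' i j by (auto simp: jump_set_def PiE_iff)
    then have g: "\<gamma> i = \<gamma>' j" using j(2) by simp
    then have "(\<rho> ^^ (\<gamma> i - 1)) i = (\<rho> ^^ (\<gamma> i - 1)) j"
      using v v' i j by (metis enat.inject)
    then have "i = j"
      using strict_mono_eq[OF strict_mono_funpow[OF \<rho>]] by metis
    then show "x \<in> (\<lambda>i. (i, \<gamma>' i)) ` A'" using i j g by auto
  qed
  have eq: "(\<lambda>i. \<beta> i - 1) ` I = (\<lambda>i. \<beta>' i - 1) ` I'"
    using b b' by blast
  show "(\<lambda>i. (i, \<beta> i)) ` I = (\<lambda>i. (i, \<beta>' i)) ` I'"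
    using sub[OF J J' eq v v'] sub[OF J' J eq[symmetric] v' v] by blast
qed

text \<open>The intended \<open>h i\<close> is the valuation of \<open>a\<^sub>i \<pi>\<^sup>i\<close>, the intended \<open>A\<close> the set of indices with
  \<open>a\<^sub>i \<noteq> 0\<close>, and the intended \<open>e\<close> the valuation of \<open>p\<close>; the last assumption is then what strong
  separability provides.\<close>

locale heights =
  fixes p n :: nat and A :: "nat set" and h :: "nat \<Rightarrow> nat" and e :: enat
  assumes prime: "prime p" and A_subset: "A \<subseteq> {1..n}" and n_in_A: "n \<in> A"
    and h_n: "h n = n" and h_less: "i \<in> A \<Longrightarrow> i \<noteq> n \<Longrightarrow> n < h i"
    and h_mod: "h i mod n = i mod n"
    and small: "\<exists>i\<in>A. \<not> p dvd i \<and> enat (h i) \<le> e"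
begin

lemma p_gt_1: "p > 1"
  using prime by (rule prime_gt_1_nat)

lemma finite_A: "finite A"
  using A_subset by (rule finite_subset) simp

definition low :: "nat \<Rightarrow> nat" where
  "low k = Min (h ` {i\<in>A. \<not> p ^ k dvd i})"

lemma low_le: "i \<in> A \<Longrightarrow> \<not> p ^ k dvd i \<Longrightarrow> low k \<le> h i"
  unfolding low_def using finite_A by (intro Min_le) auto

lemma low_attained:
  assumes "k \<ge> 1" obtains i where "i \<in> A" "\<not> p ^ k dvd i" "h i = low k"
proof -
  obtain i where "i \<in> A" "\<not> p dvd i" using small by blast
  moreover have "p dvd p ^ k" using assms by (simp add: dvd_power)
  ultimately have "{i\<in>A. \<not> p ^ k dvd i} \<noteq> {}" using dvd_trans by blast
  then have "low k \<in> h ` {i\<in>A. \<not> p ^ k dvd i}"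
    unfolding low_def using finite_A by (intro Min_in) auto
  then show ?thesis using that by auto
qed

lemma low_antimono:
  assumes "1 \<le> j" "j \<le> k" shows "low k \<le> low j"
proof -
  obtain i where "i \<in> A" "\<not> p ^ j dvd i" "h i = low j" using low_attained assms by blast
  moreover have "p ^ j dvd p ^ k" using assms by (simp add: le_imp_power_dvd)
  ultimately show ?thesis using low_le[of i k] dvd_trans by metis
qed

lemma n_le_h: "i \<in> A \<Longrightarrow> n \<le> h i"
  using h_n h_less by fastforce

lemma n_le_low: "k \<ge> 1 \<Longrightarrow> n \<le> low k"
  using low_attained n_le_h by metis

lemma low_le_e:
  assumes "k \<ge> 1" shows "enat (low k) \<le> e"
proof -
  obtain i where i: "i \<in> A" "\<not> p dvd i" "enat (h i) \<le> e" using small by blast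
  have "low k \<le> low 1" using low_antimono assms by simp
  also have "low 1 \<le> h i" using i low_le[of i 1] by simp
  finally show ?thesis using i(3) by (meson enat_ord_simps(1) order_trans)
qed

lemma low_eq_n: "k \<ge> 1 \<Longrightarrow> \<not> p ^ k dvd n \<Longrightarrow> low k = n"
  using low_le[OF n_in_A] n_le_low h_n by (metis le_antisym)

lemma dvd_h_iff: "d dvd n \<Longrightarrow> d dvd h i \<longleftrightarrow> d dvd i"
  using h_mod[of i] by (metis dvd_mod_iff)

text \<open>If \<open>p\<^sup>k\<close> divides \<open>n\<close>, then \<open>h i\<close> is congruent to \<open>i\<close> modulo \<open>p\<^sup>k\<close>; otherwise the minimum is \<open>n\<close>.\<close>

lemma not_dvd_low:
  assumes "k \<ge> 1" shows "\<not> p ^ k dvd low k"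
proof (cases "p ^ k dvd n")
  case True
  then show ?thesis using low_attained[OF assms] dvd_h_iff by metis
next
  case False
  then show ?thesis using low_eq_n[OF assms] by simp
qed

lemma h_inj: "i \<in> A \<Longrightarrow> j \<in> A \<Longrightarrow> h i = h j \<Longrightarrow> i = j"
proof -
  assume ij: "i \<in> A" "j \<in> A" "h i = h j"
  then have "i mod n = j mod n" using h_mod by metis
  moreover have "1 \<le> i" "i \<le> n" "1 \<le> j" "j \<le> n" using ij A_subset by auto
  ultimately show "i = j" by (cases "i = n"; cases "j = n") auto
qed

definition breaks :: "nat set" where
  "breaks = {k. k = 0 \<or> low (k + 1) \<noteq> low k}"

text \<open>An index at which the minimum drops becomes admissible only with \<open>k + 1\<close>, so it is divisible by
  exactly \<open>p\<^sup>k\<close>.  Once \<open>p\<^sup>k\<close> does not divide \<open>n\<close>, the minimum is \<open>n\<close> and drops no more.\<close>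

lemma breakE:
  assumes "k \<in> breaks"
  obtains i where "i \<in> A" "p ^ k dvd i" "\<not> p ^ (k + 1) dvd i" "h i = low (k + 1)" "p ^ k dvd n"
proof -
  obtain i where i: "i \<in> A" "\<not> p ^ (k + 1) dvd i" "h i = low (k + 1)"
    using low_attained[of "k + 1"] by auto
  have "p ^ k dvd i \<and> p ^ k dvd n"
  proof (cases "k = 0")
    case False
    then have k: "k \<ge> 1" "low (k + 1) \<noteq> low k" using assms by (auto simp: breaks_def)
    then have less: "low (k + 1) < low k" using low_antimono[of k "k + 1"] by simp
    have "p ^ k dvd i" using low_le[of i k] i less by fastforce
    moreover have "p ^ k dvd n"
    proof (rule ccontr)
      assume "\<not> p ^ k dvd n"
      then show False using low_eq_n k less n_le_low[of "k + 1"] by simp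
    qed
    ultimately show ?thesis by blast
  qed simp
  with i that show ?thesis by blast
qed

definition jump :: "nat \<Rightarrow> nat" where
  "jump k = low (k + 1) div p ^ k"

lemma power_jump: "k \<in> breaks \<Longrightarrow> p ^ k * jump k = low (k + 1)"
  unfolding jump_def by (metis breakE dvd_h_iff dvd_mult_div_cancel)

lemma jump_coprime:
  assumes "k \<in> breaks" shows "\<not> p dvd jump k"
proof
  assume "p dvd jump k"
  then have "p ^ k * p dvd low (k + 1)" unfolding power_jump[OF assms, symmetric] by simp
  then show False using not_dvd_low[of "k + 1"] by (simp add: mult.commute)
qed

lemma finite_breaks: "finite breaks"
proof (rule finite_subset)
  show "breaks \<subseteq> {..n}"
  proof
    fix k assume "k \<in> breaks"
    then have "p ^ k dvd n" using breakE by metis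
    moreover have "n > 0" using n_in_A A_subset by auto
    ultimately have "p ^ k \<le> n" by (rule dvd_imp_le)
    then show "k \<in> {..n}" using power_gt_expt[of p k] p_gt_1 by simp
  qed
qed simp

lemma low_strict:
  assumes "k < l" "l \<in> breaks" shows "low (l + 1) < low (k + 1)"
proof -
  have "low (l + 1) < low l"
    using assms low_antimono[of l "l + 1"] by (auto simp: breaks_def)
  also have "low l \<le> low (k + 1)" using assms by (intro low_antimono) auto
  finally show ?thesis .
qed

lemma jump_strict:
  assumes "k < l" "k \<in> breaks" "l \<in> breaks" shows "jump l < jump k"
proof (rule ccontr)
  assume "\<not> jump l < jump k"
  then have "p ^ k * jump k \<le> p ^ l * jump l"
    using assms p_gt_1 by (intro mult_mono) (auto intro: power_increasing)
  then show False using low_strict[OF assms(1,3)] assms by (simp add: power_jump)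
qed

lemma jump_less_iff: "k \<in> breaks \<Longrightarrow> l \<in> breaks \<Longrightarrow> jump k < jump l \<longleftrightarrow> l < k"
  using jump_strict by (metis less_asym linorder_neqE_nat less_irrefl)

lemma inj_jump: "inj_on jump breaks"
  using jump_less_iff by (metis inj_onI less_irrefl linorder_neqE_nat)

definition jumps :: "nat set" where
  "jumps = jump ` breaks"

definition jump_level :: "nat \<Rightarrow> nat" where
  "jump_level = (\<lambda>i\<in>jumps. Suc (the_inv_into breaks jump i))"

lemma jump_level_jump: "k \<in> breaks \<Longrightarrow> jump_level (jump k) = Suc k"
  using inj_jump by (simp add: jump_level_def jumps_def the_inv_into_f_f)

lemma graph_jump_level: "(\<lambda>i. (i, jump_level i)) ` jumps = (\<lambda>k. (jump k, Suc k)) ` breaks"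
  by (auto simp: jumps_def image_image jump_level_jump intro!: image_eqI)

lemma rho_jump:
  assumes "k \<in> breaks" "enat (low (k + 1)) \<le> e'"
  shows "(shift_rho e' p ^^ k) (jump k) = low (k + 1)"
  using assms p_gt_1 by (simp add: shift_rho_funpow_small power_jump)

text \<open>This covers both \<open>e' = e\<close> and \<open>e' = \<infinity>\<close>: the values of \<open>low\<close> do not exceed \<open>e'\<close>, and as long as
  the iterates stay below \<open>e'\<close> the shift is multiplication by \<open>p\<close>.\<close>

lemma jump_set_jumps:
  assumes e': "\<And>k. k \<ge> 1 \<Longrightarrow> enat (low k) \<le> e'"
  shows "jump_set (shift_rho e' p) (jumps, jump_level)"
proof -
  let ?\<rho> = "shift_rho e' p"
  have pos: "p > 0" using p_gt_1 by simp
  have notin: "jump k \<notin> ?\<rho> ` {1..}" and ge: "jump k \<ge> 1" if k: "k \<in> breaks" for k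
  proof -
    show "jump k \<ge> 1" using jump_coprime[OF k] by (cases "jump k") auto
    show "jump k \<notin> ?\<rho> ` {1..}"
    proof
      assume "jump k \<in> ?\<rho> ` {1..}"
      then obtain i where i: "i \<ge> 1" "jump k = ?\<rho> i" by auto
      have "jump k \<le> p ^ k * jump k" using pos by simp
      then have "enat (jump k) \<le> e'"
        using e'[of "k + 1"] power_jump[OF k] by (metis enat_ord_simps(1) le_add2 order_trans)
      moreover have "jump k \<noteq> p * i" using jump_coprime[OF k] by auto
      ultimately show False
        using i by (cases e') (auto simp: shift_rho_def min_def split: if_splits)
    qed
  qed
  have \<rho>jump: "(?\<rho> ^^ jump_level (jump k)) (jump k) = ?\<rho> (low (k + 1))" if "k \<in> breaks" for k
    using that e'[of "k + 1"] by (simp add: jump_level_jump rho_jump)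
  have "strict_antimono_on jumps jump_level"
    by (auto simp: monotone_on_def jumps_def jump_level_jump jump_less_iff)
  moreover have "strict_mono_on jumps (\<lambda>i. (?\<rho> ^^ jump_level i) i)"
    unfolding monotone_on_def jumps_def
    using low_strict strict_mono_less[OF strict_mono_shift_rho[OF pos, of e']]
    by (auto simp: \<rho>jump jump_less_iff simp del: funpow.simps)
  moreover have "jump_level \<in> jumps \<rightarrow>\<^sub>E {1..}"
    by (auto simp: jump_level_def)
  ultimately show ?thesis
    using finite_breaks notin ge by (auto simp: jump_set_def jumps_def)
qed

text \<open>On these points the order compares the exponent of \<open>p\<close> in the index and the height of the index.
  A minimal point therefore comes from an index that is lower than all others with at most the
  same exponent, which is to say that \<open>low\<close> drops there.\<close>

lemma minimal_points:
  defines "S \<equiv> {(h i div p ^ multiplicity p i, multiplicity p i + 1) | i.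
    i \<in> A \<and> multiplicity p i \<le> multiplicity p n}"
  shows "minimal_elements (jump_le (shift_rho \<infinity> p)) S = (\<lambda>k. (jump k, Suc k)) ` breaks"
proof -
  let ?m = "multiplicity p"
  define pt where "pt i = (h i div p ^ ?m i, ?m i + 1)" for i
  define G where "G = {i\<in>A. ?m i \<le> ?m n}"
  have S: "S = pt ` G" by (auto simp: S_def pt_def G_def)
  have dvd_iff: "p ^ k dvd i \<longleftrightarrow> k \<le> ?m i" if "i \<in> A" for i k
    using that A_subset p_gt_1 by (intro power_dvd_iff_le_multiplicity) auto
  have GA: "i \<in> A" if "i \<in> G" for i using that by (simp add: G_def)
  have pow: "(shift_rho \<infinity> p ^^ (?m i + 1)) (h i div p ^ ?m i) = p * h i" if "i \<in> G" for i
  proof -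
    have "p ^ ?m i dvd n" using that dvd_iff[OF n_in_A] by (simp add: G_def)
    then have "p ^ ?m i dvd h i" using dvd_h_iff multiplicity_dvd by blast
    then show ?thesis
      using p_gt_1 by (subst shift_rho_funpow_small) auto
  qed
  have le: "jump_le (shift_rho \<infinity> p) (pt i) (pt j) \<longleftrightarrow> ?m i \<le> ?m j \<and> h i \<le> h j"
    if "i \<in> G" "j \<in> G" for i j
    unfolding jump_le_def pt_def using pow that p_gt_1 by (simp del: funpow.simps)
  have mem: "pt i \<in> minimal_elements (jump_le (shift_rho \<infinity> p)) S \<longleftrightarrow>
      (\<forall>j\<in>G. ?m j \<le> ?m i \<and> h j \<le> h i \<longrightarrow> pt j = pt i)" if "i \<in> G" for i
    unfolding minimal_elements_def S using that by (simp add: le)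
  show ?thesis
  proof (intro equalityI subsetI)
    fix x assume x: "x \<in> minimal_elements (jump_le (shift_rho \<infinity> p)) S"
    then obtain i where i: "i \<in> G" "x = pt i"
      unfolding minimal_elements_def S by blast
    then have min: "\<And>j. j \<in> G \<Longrightarrow> ?m j \<le> ?m i \<Longrightarrow> h j \<le> h i \<Longrightarrow> pt j = pt i"
      using x mem by blast
    let ?k = "?m i"
    have smaller: "?m j = ?k \<and> h j = h i"
      if "j \<in> A" "\<not> p ^ (?k + 1) dvd j" "h j \<le> h i" for j
    proof -
      have "?m j \<le> ?k" using that dvd_iff by fastforce
      then have "j \<in> G" using i that by (simp add: G_def)
      then have "pt j = pt i" using min \<open>?m j \<le> ?k\<close> that by blast
      then have "?m j = ?k" by (simp add: pt_def)
      have "p * h j = p * h i"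
        using pow[OF \<open>j \<in> G\<close>] pow[OF i(1)] \<open>pt j = pt i\<close> by (metis pt_def prod.inject)
      with \<open>?m j = ?k\<close> p_gt_1 show ?thesis by simp
    qed
    have ni: "\<not> p ^ (?k + 1) dvd i" using dvd_iff[OF GA[OF i(1)], of "?k + 1"] by simp
    have hi: "h i = low (?k + 1)"
      using low_attained[of "?k + 1"] smaller low_le[OF GA[OF i(1)] ni]
      by (metis le_add2)
    have "?k \<in> breaks"
    proof (rule ccontr)
      assume "?k \<notin> breaks"
      then have k: "?k \<ge> 1" "low (?k + 1) = low ?k" by (auto simp: breaks_def)
      obtain j where j: "j \<in> A" "\<not> p ^ ?k dvd j" "h j = low ?k" using low_attained[OF k(1)] .
      moreover have "\<not> p ^ (?k + 1) dvd j" using j(2) power_le_dvd[of p "?k + 1" j ?k] by auto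
      ultimately have "?m j = ?k" using smaller hi k(2) by auto
      then show False using j dvd_iff by auto
    qed
    moreover have "x = (jump ?k, Suc ?k)"
      using i hi by (simp add: pt_def jump_def)
    ultimately show "x \<in> (\<lambda>k. (jump k, Suc k)) ` breaks" by blast
  next
    fix x assume "x \<in> (\<lambda>k. (jump k, Suc k)) ` breaks"
    then obtain k where k: "k \<in> breaks" "x = (jump k, Suc k)" by blast
    obtain i where i: "i \<in> A" "p ^ k dvd i" "\<not> p ^ (k + 1) dvd i" "h i = low (k + 1)" "p ^ k dvd n"
      using breakE[OF k(1)] .
    have mi: "?m i = k" using i by (intro multiplicity_eqI) auto
    have "i \<in> G" using i mi dvd_iff[OF n_in_A] by (simp add: G_def)
    moreover have x: "x = pt i" using mi i k by (simp add: pt_def jump_def)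
    moreover have "pt j = pt i" if j: "j \<in> G" "?m j \<le> ?m i" "h j \<le> h i" for j
    proof -
      have "\<not> p ^ (k + 1) dvd j" using j mi dvd_iff[OF GA[OF j(1)], of "k + 1"] by simp
      then have "h i \<le> h j" using low_le[OF GA[OF j(1)]] i by simp
      then have "i = j" using h_inj i(1) GA j by simp
      then show ?thesis by simp
    qed
    ultimately show "x \<in> minimal_elements (jump_le (shift_rho \<infinity> p)) S"
      using mem by blast
  qed
qed

lemma poly_jump_set_unique:
  assumes "jump_set (shift_rho \<infinity> p) (I, \<beta>)"
    and "(\<lambda>i. (i, \<beta> i)) ` I = (\<lambda>k. (jump k, Suc k)) ` breaks"
  shows "(I, \<beta>) = (jumps, jump_level)"
  using jump_set_eqI[OF assms(1) jump_set_jumps[of \<infinity>]] assms(2) graph_jump_level by simp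

end

section \<open>Weights of principal units\<close>

context local_field
begin

text \<open>The integral elements that are congruent to \<open>p\<^sup>k\<close>-th powers modulo the \<open>N\<close>-th power of the maximal
  ideal.  Because Frobenius is additive modulo \<open>p\<close>, they form a ring if \<open>p\<close> lies in that ideal.\<close>

definition power_residues :: "nat \<Rightarrow> nat \<Rightarrow> nat \<Rightarrow> 'a set" where
  "power_residues p k N = {x. \<exists>y\<in>ideal_pow v 0. x - y ^ (p ^ k) \<in> ideal_pow v N}"

lemma power_residuesI: "y \<in> ideal_pow v 0 \<Longrightarrow> x - y ^ (p ^ k) \<in> ideal_pow v N \<Longrightarrow> x \<in> power_residues p k N"
  by (auto simp: power_residues_def)

lemma power_residues_power: "y \<in> ideal_pow v 0 \<Longrightarrow> y ^ (p ^ k) \<in> power_residues p k N"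
  by (rule power_residuesI) auto

lemma power_residues_mono: "x \<in> power_residues p k N \<Longrightarrow> M \<le> N \<Longrightarrow> x \<in> power_residues p k M"
  by (auto simp: power_residues_def intro: ideal_pow_mono)

lemma power_residues_integral: "x \<in> power_residues p k N \<Longrightarrow> x \<in> ideal_pow v 0"
  unfolding power_residues_def
  using ideal_pow_cong_iff ideal_pow_mono ring_power by blast

lemma ideal_pow_power_residues:
  assumes "prime p" "x \<in> ideal_pow v N" shows "x \<in> power_residues p k N"
proof (rule power_residuesI[of 0])
  have "p ^ k > 0" using assms(1) by (simp add: prime_gt_0_nat)
  then show "x - 0 ^ (p ^ k) \<in> ideal_pow v N"
    unfolding zero_power[OF \<open>p ^ k > 0\<close>] using assms(2) by simp
qed simp

lemma power_residues_mult:
  assumes "x \<in> power_residues p k N" "x' \<in> power_residues p k N"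
  shows "x * x' \<in> power_residues p k N"
proof -
  obtain y y' where y: "y \<in> ideal_pow v 0" "x - y ^ (p ^ k) \<in> ideal_pow v N"
    "y' \<in> ideal_pow v 0" "x' - y' ^ (p ^ k) \<in> ideal_pow v N"
    using assms by (auto simp: power_residues_def)
  have "x * x' - (y * y') ^ (p ^ k) = x * (x' - y' ^ (p ^ k)) + (x - y ^ (p ^ k)) * y' ^ (p ^ k)"
    by (simp add: algebra_simps power_mult_distrib)
  also have "\<dots> \<in> ideal_pow v N"
    using y power_residues_integral[OF assms(1)]
    by (intro ideal_pow_add ideal_pow_mult_left[of x] ideal_pow_mult_right[of "x - y ^ (p ^ k)"] ring_power)
  finally show ?thesis
    using y by (intro power_residuesI[of "y * y'"]) (auto intro: ideal_pow_mult_left)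
qed

lemma power_residues_add:
  assumes p: "prime p" "of_nat p \<in> ideal_pow v N"
    and x: "x \<in> power_residues p k N" "x' \<in> power_residues p k N"
  shows "x + x' \<in> power_residues p k N"
proof -
  obtain y y' where y: "y \<in> ideal_pow v 0" "x - y ^ (p ^ k) \<in> ideal_pow v N"
    "y' \<in> ideal_pow v 0" "x' - y' ^ (p ^ k) \<in> ideal_pow v N"
    using x by (auto simp: power_residues_def)
  have "(y + y') ^ (p ^ k) - (y ^ (p ^ k) + y' ^ (p ^ k)) \<in> ideal_pow v (N + 0)"
    using p y by (intro frobenius_power_add)
  then have fr: "(y + y') ^ (p ^ k) - (y ^ (p ^ k) + y' ^ (p ^ k)) \<in> ideal_pow v N" by simp
  from ideal_pow_diff[OF ideal_pow_add[OF y(2,4)] fr]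
  have "x + x' - (y + y') ^ (p ^ k) \<in> ideal_pow v N" by (simp add: algebra_simps)
  with ideal_pow_add[OF y(1,3)] show ?thesis by (rule power_residuesI)
qed

lemma power_residues_uminus:
  assumes p: "prime p" "of_nat p \<in> ideal_pow v N" and x: "x \<in> power_residues p k N"
  shows "- x \<in> power_residues p k N"
proof -
  have nat: "of_nat m \<in> power_residues p k N" for m
  proof (induction m)
    case 0
    then show ?case using ideal_pow_power_residues[OF p(1)] by simp
  next
    case (Suc m)
    then show ?case
      using power_residues_power[of 1 p k N] p by (auto intro: power_residues_add)
  qed
  \<comment> \<open>\<open>- 1\<close> need not be a \<open>p\<^sup>k\<close>-th power if \<open>p = 2\<close>, hence the detour \<open>- 1 = (p - 1) - p\<close>.\<close>
  have "- of_nat p \<in> power_residues p k N"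
    using p by (intro ideal_pow_power_residues) auto
  from power_residues_add[OF p nat[of "p - 1"] this] have "- 1 \<in> power_residues p k N"
    using prime_gt_0_nat[OF p(1)] by (simp add: of_nat_diff)
  from power_residues_mult[OF this x] show ?thesis by simp
qed

lemma power_residues_sum:
  assumes "prime p" "of_nat p \<in> ideal_pow v N" "\<And>i. i \<in> A \<Longrightarrow> f i \<in> power_residues p k N"
  shows "sum f A \<in> power_residues p k N"
  using assms(3)
  by (induction A rule: infinite_finite_induct)
    (auto intro: power_residues_add assms(1,2) ideal_pow_power_residues)

lemma val_of_power_residue:
  assumes "x \<in> power_residues p k N" "x \<noteq> 0" "v x < int N"
  shows "int (p ^ k) dvd v x"
proof -
  obtain y where y: "x - y ^ (p ^ k) \<in> ideal_pow v N"
    using assms by (auto simp: power_residues_def)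
  define r where "r = - (x - y ^ (p ^ k))"
  have eq: "y ^ (p ^ k) = x + r" by (simp add: r_def)
  have r: "r = 0 \<or> v x < v r"
    using y assms(3) val_minus[of "x - y ^ (p ^ k)"] by (auto simp: ideal_pow_def r_def simp del: val_minus)
  have yx: "y ^ (p ^ k) \<noteq> 0" "v (y ^ (p ^ k)) = v x"
    using val_add_less[of x r] assms(2) r unfolding eq by (cases "r = 0"; simp)+
  show ?thesis
  proof (cases "y = 0")
    case True
    then have "y ^ (p ^ k) = 1" using yx(1) by (metis power_0 power_0_left)
    then show ?thesis using yx(2) by simp
  next
    case False
    then show ?thesis using yx(2) val_power[of y "p ^ k"] by (metis dvd_triv_left)
  qed
qed

lemma unit_decomposition_iff:
  assumes y: "y \<in> unit_grp v 1"
  shows "(\<exists>x\<in>unit_grp v i. u = x * y ^ m) \<longleftrightarrow> u - y ^ m \<in> ideal_pow v i"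
proof -
  have y0: "y \<noteq> 0" "v y = 0" using principal_unit[OF y] by auto
  have "(\<exists>x\<in>unit_grp v i. u = x * y ^ m) \<longleftrightarrow> u / y ^ m \<in> unit_grp v i"
    using y0 by (auto intro!: bexI[of _ "u / y ^ m"])
  also have "\<dots> \<longleftrightarrow> (u - y ^ m) / y ^ m \<in> ideal_pow v i"
    using y0 by (simp add: unit_grp_iff diff_divide_distrib)
  also have "\<dots> \<longleftrightarrow> u - y ^ m \<in> ideal_pow v i"
    using y0 by (cases "u - y ^ m = 0") (simp_all add: ideal_pow_def val_divide val_power)
  finally show ?thesis .
qed

lemma unit_weight_eqI:
  assumes "1 \<le> m" "\<exists>y\<in>unit_grp v 1. u - y ^ (p ^ k) \<in> ideal_pow v m"
    and "\<And>y. y \<in> unit_grp v 1 \<Longrightarrow> u - y ^ (p ^ k) \<notin> ideal_pow v (m + 1)"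
  shows "unit_weight p v u k = enat m"
proof -
  have "unit_weight p v u k
      = Sup {enat i | i. 1 \<le> i \<and> (\<exists>y\<in>unit_grp v 1. u - y ^ (p ^ k) \<in> ideal_pow v i)}"
    unfolding unit_weight_def using unit_decomposition_iff by (metis (no_types, lifting))
  also have "\<dots> = enat m"
  proof (rule antisym)
    show "Sup {enat i | i. 1 \<le> i \<and> (\<exists>y\<in>unit_grp v 1. u - y ^ (p ^ k) \<in> ideal_pow v i)} \<le> enat m"
    proof (rule Sup_least)
      fix w assume "w \<in> {enat i | i. 1 \<le> i \<and> (\<exists>y\<in>unit_grp v 1. u - y ^ (p ^ k) \<in> ideal_pow v i)}"
      then obtain i y where i: "w = enat i" "y \<in> unit_grp v 1" "u - y ^ (p ^ k) \<in> ideal_pow v i"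
        by blast
      have "\<not> m + 1 \<le> i" using assms(3)[OF i(2)] ideal_pow_mono[OF i(3)] by blast
      then show "w \<le> enat m" using i(1) by simp
    qed
    show "enat m \<le> Sup {enat i | i. 1 \<le> i \<and> (\<exists>y\<in>unit_grp v 1. u - y ^ (p ^ k) \<in> ideal_pow v i)}"
      using assms(1,2) by (intro Sup_upper) blast
  qed
  finally show ?thesis .
qed

lemma unit_weight_0:
  assumes "u \<in> unit_grp v 1" shows "unit_weight p v u 0 = \<infinity>"
proof -
  have "enat i \<le> unit_weight p v u 0" if "i \<ge> 1" for i
  proof -
    have "1 \<in> unit_grp v i" by (simp add: unit_grp_iff)
    then have "\<exists>x\<in>unit_grp v i. \<exists>y\<in>unit_grp v 1. u = x * y ^ (p ^ 0)"
      using assms by (intro bexI[of _ 1] bexI[of _ u]) auto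
    then show ?thesis
      unfolding unit_weight_def using that by (intro Sup_upper) blast
  qed
  then have "enat (Suc i) \<le> unit_weight p v u 0" for i by simp
  then show ?thesis
    by (metis Suc_n_not_le_n enat_ord_simps(1) not_infinity_eq)
qed

end

context uniformized_extension
begin

text \<open>As the residue field is perfect, the digits of \<open>b\<close> in an expansion in powers of the uniformizer \<open>c\<close>
  can be chosen to be \<open>p\<^sup>k\<close>-th powers.  The partial sums of such an expansion lie in the ring, and
  the remainder is eventually in the ideal.\<close>

lemma uniformizer_power_residues:
  assumes p: "prime p" "of_nat p \<in> ideal_pow vK 1" "of_nat p \<in> ideal_pow vL N"
    and c: "c \<noteq> 0" "vK c = 1" "\<iota> c \<in> L.power_residues p k N"
    and b: "b \<in> ideal_pow vK 0"
  shows "\<iota> b \<in> L.power_residues p k N"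
proof -
  have "\<exists>s\<in>ideal_pow vK 0. \<iota> s \<in> L.power_residues p k N \<and> b - s \<in> ideal_pow vK J"
    if "b \<in> ideal_pow vK 0" for b J
    using that
  proof (induction J arbitrary: b)
    case 0
    then show ?case
      using L.ideal_pow_power_residues[OF p(1)] by (intro bexI[of _ 0]) auto
  next
    case (Suc J)
    obtain t where t: "t \<in> ideal_pow vK 0" "b - t ^ (p ^ k) \<in> ideal_pow vK 1"
      using K.residue_field_perfect_power p Suc.prems by blast
    define b' where "b' = (b - t ^ (p ^ k)) / c"
    have bb': "b - t ^ (p ^ k) = c * b'" using c by (simp add: b'_def)
    have "b' \<in> ideal_pow vK 0"
      using t(2) c by (cases "b - t ^ (p ^ k) = 0") (auto simp: b'_def ideal_pow_def K.val_divide)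
    then obtain s where s: "s \<in> ideal_pow vK 0" "\<iota> s \<in> L.power_residues p k N" "b' - s \<in> ideal_pow vK J"
      using Suc.IH by blast
    have c1: "c \<in> ideal_pow vK 1" using c by (simp add: ideal_pow_def)
    have "b - (t ^ (p ^ k) + c * s) = c * (b' - s)"
      using bb' by (simp add: algebra_simps)
    also have "\<dots> \<in> ideal_pow vK (1 + J)" using c1 s(3) by (rule K.ideal_pow_mult)
    finally have "b - (t ^ (p ^ k) + c * s) \<in> ideal_pow vK (Suc J)" by simp
    moreover have "t ^ (p ^ k) + c * s \<in> ideal_pow vK 0"
      using t(1) s(1) K.ideal_pow_mono[OF c1, of 0]
      by (intro K.ideal_pow_add K.ring_power K.ideal_pow_mult_left) auto
    moreover have "\<iota> (t ^ (p ^ k) + c * s) \<in> L.power_residues p k N"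
      unfolding hom_add hom_mult hom_power using p t(1) s(2) c(3)
      by (intro L.power_residues_add L.power_residues_power L.power_residues_mult hom_ring)
    ultimately show ?case by blast
  qed
  then obtain s where s: "\<iota> s \<in> L.power_residues p k N" "b - s \<in> ideal_pow vK N"
    using b by blast
  have "\<iota> (b - s) \<in> ideal_pow vL N"
    using hom_ideal_pow[OF s(2)] n_pos by (auto intro: L.ideal_pow_mono)
  then have "\<iota> s + \<iota> (b - s) \<in> L.power_residues p k N"
    by (rule L.power_residues_add[OF p(1,3) s(1) L.ideal_pow_power_residues[OF p(1)]])
  then show ?thesis by (simp add: hom_diff)
qed

text \<open>Here \<open>\<pi>\<^sup>i\<close> is itself a \<open>p\<^sup>k\<close>-th power, and multiplication by it improves the precision by \<open>i\<close>.\<close>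

lemma power_residues_shift:
  assumes "x \<in> L.power_residues p k N" "p ^ k dvd i"
  shows "x * \<pi> ^ i \<in> L.power_residues p k (N + i)"
proof -
  obtain m where m: "i = p ^ k * m" using assms(2) by blast
  obtain y where y: "y \<in> ideal_pow vL 0" "x - y ^ (p ^ k) \<in> ideal_pow vL N"
    using assms(1) by (auto simp: L.power_residues_def)
  have \<pi>: "\<pi> ^ j \<in> ideal_pow vL j" for j
    using uniformizer by (simp add: ideal_pow_def L.val_power)
  have "x * \<pi> ^ i - (y * \<pi> ^ m) ^ (p ^ k) = (x - y ^ (p ^ k)) * \<pi> ^ i"
    by (simp add: m power_mult_distrib algebra_simps flip: power_mult)
  also have "\<dots> \<in> ideal_pow vL (N + i)" using y(2) \<pi> by (rule L.ideal_pow_mult)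
  finally show ?thesis
    using y(1) L.ideal_pow_mono[OF \<pi>, of 0 m]
    by (intro L.power_residuesI[of "y * \<pi> ^ m"] L.ideal_pow_mult_left) auto
qed

end

locale strongly_separable_extension = eisenstein_extension vK vL \<iota> n \<pi> g
  for vK :: "'k::field \<Rightarrow> int" and vL :: "'l::field \<Rightarrow> int" and \<iota> :: "'k \<Rightarrow> 'l"
    and n :: nat and \<pi> :: 'l and g :: "'k poly" +
  fixes p :: nat
  assumes residue: "residue_characteristic vK p" and sep: "strongly_separable p vK vL \<iota>"
begin

lemma prime_p: "prime p" and p_in_K: "of_nat p \<in> ideal_pow vK 1"
  using residue by (simp_all add: residue_characteristic_def)

lemma p_in_L: "of_nat p \<in> ideal_pow vL n"
  using hom_ideal_pow[OF p_in_K] by (simp add: hom_of_nat)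

lemma p_in_ideal_iff: "of_nat p \<in> ideal_pow vL N \<longleftrightarrow> enat N \<le> enat_val vL (of_nat p)"
  using p_in_L by (auto simp: ideal_pow_def enat_val_def)

definition indices :: "nat set" where
  "indices = {i\<in>{1..n}. coeff g i \<noteq> 0}"

definition term_val :: "nat \<Rightarrow> nat" where
  "term_val i = nat (vK (coeff g i)) * n + i"

sublocale heights p n indices term_val "enat_val vL (of_nat p)"
proof
  show "prime p" by (rule prime_p)
  show "indices \<subseteq> {1..n}" "n \<in> indices"
    using n_pos by (auto simp: indices_def coeff_n)
  show "term_val n = n" by (simp add: term_val_def coeff_n)
  show "term_val i mod n = i mod n" for i by (simp add: term_val_def)
  show "n < term_val i" if "i \<in> indices" "i \<noteq> n" for i
  proof -
    have i: "i < n" "i \<ge> 1" "coeff g i \<noteq> 0" using that by (auto simp: indices_def)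
    then have "1 \<le> nat (vK (coeff g i))" using coeff_less[of i] by simp
    then have "n \<le> nat (vK (coeff g i)) * n"
      using mult_le_mono1[of 1 "nat (vK (coeff g i))" n] by simp
    then show ?thesis unfolding term_val_def using i(2) by linarith
  qed
  show "\<exists>i\<in>indices. \<not> p dvd i \<and> enat (term_val i) \<le> enat_val vL (of_nat p)"
    using strongly_separable_index[OF sep] by (auto simp: indices_def term_val_def)
qed

lemma val_index_term:
  assumes "i \<in> indices" shows "vL (\<iota> (coeff g i) * \<pi> ^ i) = int (term_val i)"
proof -
  have "vK (coeff g i) \<ge> 0"
    using assms coeff_integral[of i] by (auto simp: indices_def ideal_pow_def)
  then show ?thesis
    using assms val_term[of "coeff g i" i]
    by (simp add: indices_def term_val_def mult.commute[of "int n"])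
qed

lemma term_in_ideal:
  assumes "i \<in> {1..n}" "i \<in> indices \<Longrightarrow> N \<le> term_val i"
  shows "\<iota> (coeff g i) * \<pi> ^ i \<in> ideal_pow vL N"
proof (cases "coeff g i = 0")
  case False
  then have "i \<in> indices" using assms(1) by (simp add: indices_def)
  then show ?thesis using val_index_term assms(2) by (simp add: ideal_pow_def)
qed simp

lemma coeff_0_expansion: "\<iota> (coeff g 0) = - (\<Sum>i\<in>{1..n}. \<iota> (coeff g i) * \<pi> ^ i)"
proof -
  have "{..n} = insert 0 {1..n}" by auto
  then show ?thesis using root_sum by (simp add: eq_neg_iff_add_eq_0)
qed

lemma p_in_low: "k \<ge> 1 \<Longrightarrow> N \<le> low k \<Longrightarrow> of_nat p \<in> ideal_pow vL N"
  using low_le_e p_in_ideal_iff L.ideal_pow_mono by blast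

text \<open>In the expansion of the uniformizer \<open>a\<^sub>0\<close> of \<open>K\<close>, the terms whose index is divisible by \<open>p\<^sup>k\<close> gain
  precision, and the other terms have valuation at least \<open>low k\<close>.  So the precision can be raised step
  by step up to \<open>low k\<close>.\<close>

lemma integers_power_residues:
  assumes k: "k \<ge> 1" and "N \<le> low k" and "b \<in> ideal_pow vK 0"
  shows "\<iota> b \<in> L.power_residues p k N"
  using assms(2,3)
proof (induction N arbitrary: b)
  case 0
  then show ?case
    using L.ideal_pow_power_residues[OF prime_p] hom_ring by blast
next
  case (Suc N)
  have pN: "of_nat p \<in> ideal_pow vL (Suc N)" using p_in_low k Suc.prems by blast
  have "\<iota> (coeff g i) * \<pi> ^ i \<in> L.power_residues p k (Suc N)" if i: "i \<in> {1..n}" for i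
  proof (cases "p ^ k dvd i")
    case True
    have "\<iota> (coeff g i) \<in> L.power_residues p k N"
      using Suc.IH Suc.prems coeff_integral by simp
    from power_residues_shift[OF this True] show ?thesis
      by (rule L.power_residues_mono) (use i in auto)
  next
    case False
    have "Suc N \<le> term_val i" if "i \<in> indices"
      using low_le[OF that False] Suc.prems by simp
    then show ?thesis
      using i by (intro L.ideal_pow_power_residues prime_p term_in_ideal)
  qed
  then have "\<iota> (coeff g 0) \<in> L.power_residues p k (Suc N)"
    unfolding coeff_0_expansion using pN prime_p
    by (intro L.power_residues_uminus L.power_residues_sum)
  then show ?case
    using uniformizer_power_residues[OF prime_p p_in_K pN coeff_0] Suc.prems by blast
qed

text \<open>If \<open>p \<noteq> 0\<close>, the valuation of \<open>p\<close> is at least \<open>low k\<close> and is a multiple of \<open>n\<close>, hence of \<open>p\<^sup>k\<close>, which \<open>low k\<close> is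
  not.\<close>

lemma p_in_Suc_low:
  assumes k: "k \<ge> 1" and kn: "p ^ k dvd n"
  shows "of_nat p \<in> ideal_pow vL (low k + 1)"
proof (cases "of_nat p = (0::'l)")
  case False
  then have "vL (of_nat p) = int n * vK (of_nat p)"
    using val_hom[of "of_nat p"] hom_of_nat[of p] by (metis hom_eq_0_iff)
  then have "int (p ^ k) dvd vL (of_nat p)"
    using kn by (simp add: dvd_mult2 del: of_nat_power)
  then have "vL (of_nat p) \<noteq> int (low k)"
    using not_dvd_low[OF k] by (metis int_dvd_int_iff)
  moreover have "int (low k) \<le> vL (of_nat p)"
    using p_in_low[OF k, of "low k"] False by (simp add: ideal_pow_def)
  ultimately show ?thesis by (simp add: ideal_pow_def)
qed simp

text \<open>Otherwise all integers of \<open>K\<close> would be congruent to \<open>p\<^sup>k\<close>-th powers to this precision.  In the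
  expansion of \<open>a\<^sub>0\<close> this would hold for every term except the one of valuation \<open>low k\<close>, and hence for
  that term too; but its valuation is not divisible by \<open>p\<^sup>k\<close>.\<close>

lemma uniformizer_not_power_residue:
  assumes k: "k \<ge> 1" and kn: "p ^ k dvd n" and c: "c \<noteq> 0" "vK c = 1"
  shows "\<iota> c \<notin> L.power_residues p k (low k + 1)"
proof
  let ?N = "low k + 1"
  let ?t = "\<lambda>j. \<iota> (coeff g j) * \<pi> ^ j"
  assume cN: "\<iota> c \<in> L.power_residues p k ?N"
  have pN: "of_nat p \<in> ideal_pow vL ?N" using p_in_Suc_low[OF k kn] .
  have int: "\<iota> b \<in> L.power_residues p k ?N" if "b \<in> ideal_pow vK 0" for b
    using uniformizer_power_residues[OF prime_p p_in_K pN c cN that] .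
  obtain i where i: "i \<in> indices" "\<not> p ^ k dvd i" "term_val i = low k"
    using low_attained[OF k] .
  have rest: "?t j \<in> L.power_residues p k ?N" if j: "j \<in> {1..n} - {i}" for j
  proof (cases "p ^ k dvd j")
    case True
    show ?thesis
      using power_residues_shift[OF int[OF coeff_integral] True]
      by (rule L.power_residues_mono) simp
  next
    case False
    have "?N \<le> term_val j" if "j \<in> indices"
    proof -
      have "term_val j \<noteq> low k" using h_inj[OF that i(1)] i(3) j by auto
      then show ?thesis using low_le[OF that False] by simp
    qed
    then show ?thesis
      using j by (intro L.ideal_pow_power_residues prime_p term_in_ideal) auto
  qed
  have "i \<in> {1..n}" using i by (simp add: indices_def)
  then have "(\<Sum>j\<in>{1..n}. ?t j) = ?t i + (\<Sum>j\<in>{1..n} - {i}. ?t j)"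
    by (simp add: sum.remove)
  then have "?t i = - \<iota> (coeff g 0) + - (\<Sum>j\<in>{1..n} - {i}. ?t j)"
    unfolding coeff_0_expansion by simp
  also have "\<dots> \<in> L.power_residues p k ?N"
    using rest prime_p pN int[OF coeff_integral[of 0]]
    by (intro L.power_residues_add L.power_residues_uminus L.power_residues_sum)
  finally have "?t i \<in> L.power_residues p k ?N" .
  moreover have "?t i \<noteq> 0" using i uniformizer by (simp add: indices_def)
  moreover have "vL (?t i) = int (low k)" using i by (simp only: val_index_term)
  ultimately have "int (p ^ k) dvd int (low k)"
    using L.val_of_power_residue[of "?t i" p k ?N] by simp
  then show False using not_dvd_low[OF k] by (simp only: int_dvd_int_iff)
qed

text \<open>If \<open>p\<^sup>k\<close> does not divide \<open>n\<close>, then the valuation of \<open>p\<close> may be equal to \<open>low k = n\<close>, and the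
  ring argument is not available modulo \<open>\<pi>\<^sup>n\<^sup>+\<^sup>1\<close>.  In this case the
  \<open>p\<^sup>k\<close>-th power of \<open>y = 1 + z\<close> is compared with 1 plus that of \<open>z\<close>.  The two agree modulo
  \<open>\<pi>\<^sup>n\<^sup>+\<^sup>1\<close>, since the error contains the factors \<open>p\<close> and \<open>z\<close>; so \<open>u - 1\<close>, of valuation \<open>n\<close>, would
  be congruent to a \<open>p\<^sup>k\<close>-th power.\<close>

lemma unit_weight_eq_low:
  assumes u: "u \<in> unit_grp vK 1 - unit_grp vK 2" and k: "k \<ge> 1"
  shows "unit_weight p vL (\<iota> u) k = enat (low k)"
proof -
  have u1: "u - 1 \<noteq> 0" "vK (u - 1) = 1"
    using u by (auto simp: K.unit_grp_iff ideal_pow_def)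
  have u0: "u \<in> ideal_pow vK 0"
    using K.ideal_pow_add[of "u - 1" 0 1] u1 by (simp add: ideal_pow_def)
  have low1: "low k \<ge> 1" using n_le_low[OF k] n_pos by simp
  have \<iota>u1: "\<iota> u - 1 \<in> ideal_pow vL 1" and v\<iota>u1: "vL (\<iota> u - 1) = int n" "\<iota> u - 1 \<noteq> 0"
  proof -
    have eq: "\<iota> u - 1 = \<iota> (u - 1)" by (simp add: hom_diff hom_one)
    then show "vL (\<iota> u - 1) = int n" using val_hom[OF u1(1)] u1(2) by simp
    show "\<iota> u - 1 \<noteq> 0" unfolding eq using u1 by simp
    then show "\<iota> u - 1 \<in> ideal_pow vL 1"
      using n_pos \<open>vL (\<iota> u - 1) = int n\<close> by (simp add: ideal_pow_def)
  qed
  have p1: "of_nat p \<in> ideal_pow vL 1"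
    using p_in_L n_pos by (auto intro: L.ideal_pow_mono)
  show ?thesis
  proof (rule L.unit_weight_eqI)
    show "1 \<le> low k" by (rule low1)
    obtain y where y: "y \<in> ideal_pow vL 0" "\<iota> u - y ^ (p ^ k) \<in> ideal_pow vL (low k)"
      using integers_power_residues[OF k order_refl u0] by (auto simp: L.power_residues_def)
    have "y ^ (p ^ k) - 1 ^ (p ^ k) = (\<iota> u - 1) - (\<iota> u - y ^ (p ^ k))" by simp
    also have "\<dots> \<in> ideal_pow vL 1"
      using \<iota>u1 L.ideal_pow_mono[OF y(2) low1] by (rule L.ideal_pow_diff)
    finally have "y - 1 \<in> ideal_pow vL 1"
      using prime_p p1 y(1) by (intro L.frobenius_power_inject[of p y 1 k]) auto
    then show "\<exists>y\<in>unit_grp vL 1. \<iota> u - y ^ (p ^ k) \<in> ideal_pow vL (low k)"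
      using y(2) by (auto simp: L.unit_grp_iff)
  next
    fix y assume y: "y \<in> unit_grp vL 1"
    then have y1: "y - 1 \<in> ideal_pow vL 1" by (simp add: L.unit_grp_iff)
    have y0: "y \<in> ideal_pow vL 0" using L.principal_unit[OF y] by (simp add: ideal_pow_def)
    show "\<iota> u - y ^ (p ^ k) \<notin> ideal_pow vL (low k + 1)"
    proof
      assume asm: "\<iota> u - y ^ (p ^ k) \<in> ideal_pow vL (low k + 1)"
      show False
      proof (cases "p ^ k dvd n")
        case True
        have "\<iota> u \<in> L.power_residues p k (low k + 1)"
          using y0 asm by (rule L.power_residuesI)
        moreover have "- (1 ^ (p ^ k)) \<in> L.power_residues p k (low k + 1)"
          using prime_p p_in_Suc_low[OF k True] L.one_in_ring
          by (intro L.power_residues_uminus L.power_residues_power)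
        ultimately have "\<iota> u + - (1 ^ (p ^ k)) \<in> L.power_residues p k (low k + 1)"
          by (rule L.power_residues_add[OF prime_p p_in_Suc_low[OF k True]])
        then show False
          using uniformizer_not_power_residue[OF k True u1] by (simp add: hom_diff hom_one)
      next
        case False
        then have low: "low k = n" by (rule low_eq_n[OF k])
        have "(1 + (y - 1)) ^ (p ^ k) - (1 ^ (p ^ k) + (y - 1) ^ (p ^ k)) \<in> ideal_pow vL (n + 1)"
          using prime_p p_in_L y1 by (intro L.frobenius_power_add) auto
        from L.ideal_pow_add[OF this asm[unfolded low]]
        have "\<iota> u - 1 - (y - 1) ^ (p ^ k) \<in> ideal_pow vL (n + 1)" by (simp add: algebra_simps)
        then have "\<iota> u - 1 \<in> L.power_residues p k (n + 1)"
          using L.ideal_pow_mono[OF y1, of 0] by (intro L.power_residuesI[of "y - 1"]) auto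
        from L.val_of_power_residue[OF this] have "int (p ^ k) dvd int n"
          using v\<iota>u1 by simp
        with False show False by (simp only: int_dvd_int_iff)
      qed
    qed
  qed
qed

lemma unit_jump_set_eq:
  assumes u: "u \<in> unit_grp vK 1 - unit_grp vK 2"
  shows "unit_jump_set p vL (\<iota> u) = (jumps, jump_level)"
proof -
  define w where "w = unit_weight p vL (\<iota> u)"
  define e where "e = enat_val vL (of_nat p)"
  have "\<iota> u - 1 \<in> ideal_pow vL 1"
  proof -
    have "u - 1 \<in> ideal_pow vK 1" using u by (simp add: K.unit_grp_iff)
    then have "\<iota> (u - 1) \<in> ideal_pow vL (n * 1)" by (rule hom_ideal_pow)
    then show ?thesis
      using n_pos by (auto simp: hom_diff hom_one intro: L.ideal_pow_mono)
  qed
  then have w0: "w 0 = \<infinity>"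
    unfolding w_def by (intro L.unit_weight_0) (simp add: L.unit_grp_iff)
  have w: "w k = enat (low k)" if "k \<ge> 1" for k
    unfolding w_def using unit_weight_eq_low[OF u that] .
  have "w k \<noteq> w (k + 1) \<longleftrightarrow> k \<in> breaks" for k
    using w0 w[of k] w[of "k + 1"] by (cases "k = 0") (auto simp: breaks_def)
  moreover have "(\<lambda>i. jump_level i - 1) ` jumps = breaks"
    by (force simp: jumps_def jump_level_jump image_image)
  ultimately have br: "\<forall>k. w k \<noteq> w (k + 1) \<longleftrightarrow> k \<in> (\<lambda>i. jump_level i - 1) ` jumps"
    by simp
  have val: "\<forall>i\<in>jumps. w (jump_level i) = enat ((shift_rho e p ^^ (jump_level i - 1)) i)"
    using w rho_jump[of _ e] low_le_e by (auto simp: jumps_def jump_level_jump e_def)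
  have J: "jump_set (shift_rho e p) (jumps, jump_level)"
    using low_le_e by (intro jump_set_jumps) (simp add: e_def)
  show ?thesis
    unfolding unit_jump_set_def Let_def w_def[symmetric] e_def[symmetric]
  proof (rule the_equality)
    fix J' assume "case J' of (I, \<beta>) \<Rightarrow> jump_set (shift_rho e p) (I, \<beta>) \<and>
      (\<forall>k. w k \<noteq> w (k + 1) \<longleftrightarrow> k \<in> (\<lambda>i. \<beta> i - 1) ` I) \<and>
      (\<forall>i\<in>I. w (\<beta> i) = enat ((shift_rho e p ^^ (\<beta> i - 1)) i))"
    then show "J' = (jumps, jump_level)"
      using jump_set_of_weight_unique[OF strict_mono_shift_rho _ J _ br _ val] p_gt_1
      by (cases J') auto
  qed (use J br val in auto)
qed

lemma ext_jump_set_eq: "ext_jump_set p vK vL \<iota> = (jumps, jump_level)"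
proof -
  have u: "1 + coeff g 0 \<in> unit_grp vK 1 - unit_grp vK 2"
    using coeff_0 by (simp add: K.unit_grp_iff ideal_pow_def)
  show ?thesis
    unfolding ext_jump_set_def
  proof (rule the_equality)
    fix J assume "\<forall>u\<in>unit_grp vK 1 - unit_grp vK 2. unit_jump_set p vL (\<iota> u) = J"
    then show "J = (jumps, jump_level)" using u unit_jump_set_eq by metis
  qed (use unit_jump_set_eq in blast)
qed

lemma poly_jump_set_eq: "poly_jump_set p vK g = (jumps, jump_level)"
proof -
  have pts: "poly_points p vK g = {(term_val i div p ^ multiplicity p i, multiplicity p i + 1) | i.
      i \<in> indices \<and> multiplicity p i \<le> multiplicity p n}"
    by (auto simp: poly_points_def indices_def term_val_def degree_g)
  show ?thesis
    unfolding poly_jump_set_def pts minimal_points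
  proof (rule the_equality)
    fix J assume "case J of (I, \<beta>) \<Rightarrow> jump_set (shift_rho \<infinity> p) (I, \<beta>) \<and>
      (\<lambda>i. (i, \<beta> i)) ` I = (\<lambda>k. (jump k, Suc k)) ` breaks"
    then show "J = (jumps, jump_level)"
      using poly_jump_set_unique by (cases J) auto
  qed (use jump_set_jumps[of \<infinity>] graph_jump_level in auto)
qed

end

section \<open>The Newton polygon\<close>

text \<open>The points on or above the convex hull of \<open>A\<close> form a convex set, which contains \<open>B\<close> and hence its
  convex hull.\<close>

lemma lower_convex_hull_eqI:
  assumes sub: "A \<subseteq> B" and above: "\<And>x y. (x, y) \<in> B \<Longrightarrow> \<exists>y'\<le>y. (x, y') \<in> convex hull A"
  shows "lower_convex_hull A = lower_convex_hull B"
proof -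
  define U where "U = {(x, y). \<exists>y'\<le>y. (x, y') \<in> convex hull A}"
  have "convex U"
    unfolding convex_alt
  proof (intro ballI allI impI)
    fix s t :: "real \<times> real" and u :: real
    assume "s \<in> U" "t \<in> U" and u: "0 \<le> u \<and> u \<le> 1"
    then obtain a b where a: "a \<le> snd s" "(fst s, a) \<in> convex hull A"
      and b: "b \<le> snd t" "(fst t, b) \<in> convex hull A"
      by (auto simp: U_def)
    have "(1 - u) *\<^sub>R (fst s, a) + u *\<^sub>R (fst t, b) \<in> convex hull A"
      using a b u by (intro convexD convex_convex_hull) auto
    moreover have "(1 - u) * a + u * b \<le> (1 - u) * snd s + u * snd t"
      using a b u by (intro add_mono mult_left_mono) auto
    ultimately show "(1 - u) *\<^sub>R s + u *\<^sub>R t \<in> U"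
      by (cases s; cases t) (auto simp: U_def)
  qed
  moreover have "B \<subseteq> U" using above by (auto simp: U_def)
  ultimately have "convex hull B \<subseteq> U" by (simp add: hull_minimal)
  then have hull: "\<exists>y'\<le>y. (x, y') \<in> convex hull A" if "(x, y) \<in> convex hull B" for x y
    using that by (auto simp: U_def)
  have AB: "convex hull A \<subseteq> convex hull B" using sub by (rule hull_mono)
  show ?thesis
  proof (intro equalityI subsetI)
    fix z assume "z \<in> lower_convex_hull A"
    then show "z \<in> lower_convex_hull B"
      unfolding lower_convex_hull_def using AB hull by (auto dest!: hull)
  next
    fix z assume "z \<in> lower_convex_hull B"
    then obtain x y where z: "z = (x, y)" "(x, y) \<in> convex hull B"
      and min: "\<And>y'. (x, y') \<in> convex hull B \<Longrightarrow> y \<le> y'"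
      by (auto simp: lower_convex_hull_def)
    obtain y' where y': "y' \<le> y" "(x, y') \<in> convex hull A" using hull z by blast
    then have "y' = y" using min AB by (meson antisym subsetD)
    then show "z \<in> lower_convex_hull A"
      unfolding lower_convex_hull_def using z y' min AB by auto
  qed
qed

lemma convex_descending_segment:
  fixes H :: "(real \<times> real) set"
  assumes H: "convex H" and ends: "(x1, y1) \<in> H" "(x2, y2) \<in> H" and x: "x1 \<le> x" "x \<le> x2" and "y2 \<le> y1"
  shows "\<exists>y\<le>y1. (x, y) \<in> H"
proof (cases "x1 = x2")
  case True
  then show ?thesis using ends x by (auto intro!: exI[of _ y1])
next
  case False
  define t where "t = (x - x1) / (x2 - x1)"
  have t: "0 \<le> t" "t \<le> 1" using x False by (auto simp: t_def field_simps)
  have "(1 - t) *\<^sub>R (x1, y1) + t *\<^sub>R (x2, y2) \<in> H"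
    using H ends t by (intro convexD) auto
  moreover have "t * (x2 - x1) = x - x1" using False by (simp add: t_def)
  then have "(1 - t) * x1 + t * x2 = x" by (simp add: algebra_simps)
  moreover have "t * y2 \<le> t * y1" using t \<open>y2 \<le> y1\<close> by (intro mult_left_mono)
  then have "(1 - t) * y1 + t * y2 \<le> y1" by (simp add: algebra_simps)
  ultimately show ?thesis by auto
qed

lemma prime_dvd_choose_of_power_dvd:
  fixes p :: nat
  assumes p: "prime p" and i: "p ^ m dvd i" and k: "\<not> p ^ m dvd k"
  shows "p dvd (i choose k)"
proof (rule ccontr)
  assume "\<not> p dvd (i choose k)"
  then have "coprime (p ^ m) (i choose k)"
    using p by (simp add: prime_imp_coprime)
  moreover have "k > 0" using k by (cases k) auto
  then have "k * (i choose k) = i * ((i - 1) choose (k - 1))"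
    by (rule times_binomial_minus1_eq)
  then have "p ^ m dvd k * (i choose k)" using i by simp
  ultimately show False using k by (simp add: coprime_dvd_mult_left_iff)
qed

lemma prime_not_dvd_choose_power:
  fixes p :: nat
  assumes p: "prime p" and i: "p ^ k dvd i" "\<not> p ^ (k + 1) dvd i"
  shows "\<not> p dvd (i choose p ^ k)"
proof -
  obtain m where m: "i = p ^ k * m" using i(1) by blast
  then have pm: "\<not> p dvd m" using i(2) by auto
  then have m0: "m > 0" by (cases m) auto
  have "multiplicity p (i choose p ^ k) = 0"
    unfolding m using const_p_fac[OF m0 p] pm by (simp add: not_dvd_imp_multiplicity_0)
  moreover have "i choose p ^ k \<noteq> 0"
    using m m0 by simp
  ultimately show ?thesis
    using p by (metis multiplicity_eq_zero_iff not_prime_unit)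
qed

lemma coeff_pcompose_linear:
  fixes a :: "'a::comm_ring_1"
  shows "coeff (pcompose f [:a, a:]) k = (\<Sum>i\<le>degree f. of_nat (i choose k) * coeff f i * a ^ i)"
proof -
  have "degree (map_poly (\<lambda>x. [:x:]) f) = degree f"
    by (rule degree_map_poly) simp
  then have "pcompose f [:a, a:] = (\<Sum>i\<le>degree f. [:coeff f i:] * [:a, a:] ^ i)"
    by (simp add: pcompose_altdef poly_altdef coeff_map_poly)
  moreover have "coeff ([:coeff f i:] * [:a, a:] ^ i) k = of_nat (i choose k) * coeff f i * a ^ i" for i
  proof (cases "k \<le> i")
    case True
    then have "a ^ i = a ^ k * a ^ (i - k)" by (simp flip: power_add)
    with True show ?thesis by (simp add: coeff_linear_poly_power mult_ac)
  next
    case False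
    have "degree ([:a, a:] ^ i) \<le> 1 * i"
      by (rule order_trans[OF degree_power_le]) (simp add: degree_pCons_le)
    then show ?thesis using False by (simp add: coeff_eq_0 binomial_eq_0)
  qed
  ultimately show ?thesis by (simp add: coeff_sum)
qed

lemma (in heights) break_below:
  "\<exists>b\<in>breaks. b \<le> m \<and> low (b + 1) = low (m + 1)"
proof (induction m)
  case 0
  then show ?case by (auto simp: breaks_def)
next
  case (Suc m)
  then show ?case
    by (cases "Suc m \<in> breaks") (auto simp: breaks_def intro: le_SucI)
qed

definition jump_points :: "nat \<Rightarrow> nat \<Rightarrow> nat set \<times> (nat \<Rightarrow> nat) \<Rightarrow> (real \<times> real) set" where
  "jump_points p n = (\<lambda>(I, \<beta>).
     (\<lambda>i. (real (p ^ (\<beta> i - 1)), real (p ^ (\<beta> i - 1) * i))) ` I \<union> {(real n, real n)})"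

context strongly_separable_extension
begin

lemma coeff_twist:
  assumes "k \<ge> 1"
  shows "coeff (twist_poly \<iota> g \<pi>) k = (\<Sum>i\<in>{1..n}. \<iota> (of_nat (i choose k) * coeff g i) * \<pi> ^ i)"
proof -
  have "degree (map_poly \<iota> g) = n"
    using degree_g by (simp add: degree_map_poly)
  then have "coeff (twist_poly \<iota> g \<pi>) k = (\<Sum>i\<le>n. \<iota> (of_nat (i choose k) * coeff g i) * \<pi> ^ i)"
    by (simp add: twist_poly_def coeff_pcompose_linear coeff_map_poly hom_mult hom_of_nat)
  also have "\<dots> = (\<Sum>i\<in>{1..n}. \<iota> (of_nat (i choose k) * coeff g i) * \<pi> ^ i)"
    using assms by (intro sum.mono_neutral_right) (auto simp: binomial_eq_0 not_le less_Suc_eq)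
  finally show ?thesis .
qed

lemma coeff_0_twist: "coeff (twist_poly \<iota> g \<pi>) 0 = 0"
  using root by (simp add: twist_poly_def eval_at_def)

lemma degree_twist: "degree (twist_poly \<iota> g \<pi>) \<le> n"
proof -
  have "degree (twist_poly \<iota> g \<pi>) \<le> degree (map_poly \<iota> g) * degree [:\<pi>, \<pi>:]"
    unfolding twist_poly_def by (rule degree_pcompose_le)
  also have "\<dots> = n" using degree_g uniformizer by (simp add: degree_map_poly)
  finally show ?thesis .
qed

lemma coeff_n_twist: "coeff (twist_poly \<iota> g \<pi>) n = \<pi> ^ n"
proof -
  have "coeff (twist_poly \<iota> g \<pi>) n = (\<Sum>i\<in>{1..n}. if i = n then \<pi> ^ n else 0)"
    unfolding coeff_twist[OF n_pos[unfolded Suc_le_eq[symmetric] One_nat_def[symmetric]]]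
    by (intro sum.cong) (auto simp: binomial_eq_0 coeff_n hom_one)
  also have "\<dots> = \<pi> ^ n" using n_pos by (simp add: sum.delta)
  finally show ?thesis .
qed

text \<open>An index \<open>i\<close> that is not divisible by \<open>p\<^sup>m\<^sup>+\<^sup>1\<close> contributes a term of valuation at least
  \<open>low (m + 1)\<close> by definition.  For any other index the binomial coefficient is divisible by \<open>p\<close>,
  whose valuation is at least \<open>low (m + 1)\<close>.\<close>

lemma coeff_twist_ideal:
  assumes k: "k \<ge> 1" and m: "\<not> p ^ (m + 1) dvd k"
  shows "coeff (twist_poly \<iota> g \<pi>) k \<in> ideal_pow vL (low (m + 1))"
  unfolding coeff_twist[OF k]
proof (rule L.ideal_pow_sum)
  fix i assume i: "i \<in> {1..n}"
  have eq: "\<iota> (of_nat (i choose k) * coeff g i) * \<pi> ^ i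
      = of_nat (i choose k) * (\<iota> (coeff g i) * \<pi> ^ i)"
    by (simp add: hom_mult hom_of_nat mult.assoc)
  show "\<iota> (of_nat (i choose k) * coeff g i) * \<pi> ^ i \<in> ideal_pow vL (low (m + 1))"
    unfolding eq
  proof (cases "p ^ (m + 1) dvd i")
    case True
    obtain c where c: "i choose k = p * c"
      using prime_dvd_choose_of_power_dvd[OF prime_p True m] by blast
    have pl: "of_nat p \<in> ideal_pow vL (low (m + 1))" by (rule p_in_low[of "m + 1"]) auto
    have t: "\<iota> (coeff g i) * \<pi> ^ i \<in> ideal_pow vL 0"
      using i by (intro term_in_ideal) auto
    show "of_nat (i choose k) * (\<iota> (coeff g i) * \<pi> ^ i) \<in> ideal_pow vL (low (m + 1))"
      unfolding c of_nat_mult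
      by (rule L.ideal_pow_mult_right[OF L.ideal_pow_mult_right[OF pl L.ring_of_nat] t])
  next
    case False
    then show "of_nat (i choose k) * (\<iota> (coeff g i) * \<pi> ^ i) \<in> ideal_pow vL (low (m + 1))"
      using i low_le by (intro L.ideal_pow_of_nat_mult term_in_ideal) auto
  qed
qed

text \<open>The index \<open>i\<close> of the break contributes a term of valuation \<open>low (k + 1)\<close>, because \<open>p\<close> does not divide
  \<open>i choose p\<^sup>k\<close>.  It is not cancelled: the binomial coefficients lie in \<open>K\<close>, so all the terms
  still have distinct valuations modulo \<open>n\<close>.\<close>

lemma coeff_twist_break:
  assumes k: "k \<in> breaks"
  defines "c \<equiv> coeff (twist_poly \<iota> g \<pi>) (p ^ k)"
  shows "c \<noteq> 0 \<and> vL c = int (low (k + 1))"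
proof -
  obtain i where i: "i \<in> indices" "p ^ k dvd i" "\<not> p ^ (k + 1) dvd i" "term_val i = low (k + 1)"
    using breakE[OF k] .
  define b where "b j = of_nat (j choose p ^ k) * coeff g j" for j
  have pk: "p ^ k \<ge> 1" using p_gt_1 by simp
  have unit: "of_nat (i choose p ^ k) \<noteq> (0::'k)" "vK (of_nat (i choose p ^ k)) = 0"
    using K.val_of_nat_coprime[OF prime_p p_in_K prime_not_dvd_choose_power[OF prime_p i(2,3)]] by auto
  have gi: "i \<in> {1..n}" "coeff g i \<noteq> 0" using i(1) by (auto simp: indices_def)
  then have bi: "b i \<noteq> 0" "vK (b i) = vK (coeff g i)"
    using unit by (auto simp: b_def K.val_mult)
  have c: "c = (\<Sum>j\<in>{1..n}. \<iota> (b j) * \<pi> ^ j)"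
    unfolding c_def coeff_twist[OF pk] b_def ..
  have "\<exists>j\<in>{1..n}. b j \<noteq> 0" using gi bi by blast
  from val_expansion[OF _ inj_mod_atLeastAtMost this]
  have "c \<noteq> 0" and le: "vL c \<le> int n * vK (b i) + int i"
    unfolding c using gi(1) bi(1) by fastforce+
  moreover have "int n * vK (b i) + int i = int (low (k + 1))"
    using val_index_term[OF i(1)] val_term[OF gi(2)] bi(2) i(4) by simp
  moreover have "\<not> p ^ (k + 1) dvd p ^ k"
    using p_gt_1 by (simp add: dvd_power_iff_le del: power_Suc)
  from coeff_twist_ideal[OF pk this] have "c = 0 \<or> int (low (k + 1)) \<le> vL c"
    by (simp add: c_def ideal_pow_def)
  ultimately show ?thesis by auto
qed

lemma jump_points_eq:
  "jump_points p n (jumps, jump_level) = (\<lambda>k. (real (p ^ k), real (low (k + 1)))) ` breaks \<union> {(real n, real n)}"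
proof -
  have "(\<lambda>i. (real (p ^ (jump_level i - 1)), real (p ^ (jump_level i - 1) * i))) ` jumps
      = (\<lambda>k. (real (p ^ k), real (low (k + 1)))) ` breaks"
    unfolding jumps_def image_image
    by (intro image_cong refl) (simp add: jump_level_jump power_jump del: of_nat_mult of_nat_power)
  then show ?thesis by (simp add: jump_points_def)
qed

text \<open>The jump points are among the points of the Newton polygon.  For any other point, at \<open>k\<close>, take the
  last break \<open>b\<close> not exceeding the exponent of \<open>p\<close> in \<open>k\<close>: the point lies at least as high as the
  jump point at \<open>p\<^sup>b \<le> k\<close>, and the segment from there to \<open>(n, n)\<close> does not rise.\<close>

lemma newton_polygon_eq:
  "newton_polygon vL (twist_poly \<iota> g \<pi>) = lower_convex_hull (jump_points p n (jumps, jump_level))"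
  unfolding newton_polygon_def jump_points_eq
proof (rule lower_convex_hull_eqI[symmetric])
  let ?c = "coeff (twist_poly \<iota> g \<pi>)"
  let ?A = "(\<lambda>k. (real (p ^ k), real (low (k + 1)))) ` breaks \<union> {(real n, real n)}"
  have n: "?c n \<noteq> 0" "vL (?c n) = int n"
    using uniformizer by (simp_all add: coeff_n_twist L.val_power)
  show "?A \<subseteq> {(real k, real_of_int (vL (?c k))) |k. ?c k \<noteq> 0}"
  proof
    fix z assume "z \<in> ?A"
    then consider "z = (real n, real n)" | k where "k \<in> breaks" "z = (real (p ^ k), real (low (k + 1)))"
      by blast
    then show "z \<in> {(real k, real_of_int (vL (?c k))) |k. ?c k \<noteq> 0}"
    proof cases
      case 1
      then show ?thesis using n by force
    next
      case 2
      then show ?thesis using coeff_twist_break[of k] by force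
    qed
  qed
  fix x y :: real assume "(x, y) \<in> {(real k, real_of_int (vL (?c k))) |k. ?c k \<noteq> 0}"
  then obtain k where k: "x = real k" "y = real_of_int (vL (?c k))" "?c k \<noteq> 0" by auto
  have k1: "k \<ge> 1" using k(3) coeff_0_twist by (cases k) auto
  have kn: "k \<le> n" using le_degree[OF k(3)] degree_twist by simp
  define m where "m = multiplicity p k"
  have "\<not> is_unit p" using p_gt_1 by simp
  then have dvd: "p ^ j dvd k \<longleftrightarrow> j \<le> m" for j
    using k1 by (simp add: m_def power_dvd_iff_le_multiplicity)
  obtain b where b: "b \<in> breaks" "b \<le> m" "low (b + 1) = low (m + 1)" using break_below by blast
  have "p ^ b dvd k" using b dvd by simp
  then have "p ^ b \<le> k" using k1 by (intro dvd_imp_le) auto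
  have "(real (p ^ b), real (low (b + 1))) \<in> convex hull ?A" "(real n, real n) \<in> convex hull ?A"
    using b by (auto intro!: hull_inc)
  moreover have "real (p ^ b) \<le> x" "x \<le> real n" using \<open>p ^ b \<le> k\<close> kn k(1) by (simp_all only: of_nat_le_iff)
  moreover have "real n \<le> real (low (b + 1))" using n_le_low[of "b + 1"] by simp
  ultimately obtain y' where y': "y' \<le> real (low (b + 1))" "(x, y') \<in> convex hull ?A"
    using convex_descending_segment[OF convex_convex_hull] by blast
  have "\<not> p ^ (m + 1) dvd k" using dvd[of "m + 1"] by simp
  from coeff_twist_ideal[OF k1 this] have "int (low (m + 1)) \<le> vL (?c k)"
    using k(3) by (simp add: ideal_pow_def)
  then have "real (low (b + 1)) \<le> y" using b(3) k(2) by linarith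
  with y' show "\<exists>y'\<le>y. (x, y') \<in> convex hull ?A" by (meson order_trans)
qed

end

theorem theorem1p14:
  fixes vK :: "'k::field \<Rightarrow> int" and vL :: "'l::field \<Rightarrow> int" and \<iota> :: "'k \<Rightarrow> 'l"
    and p n :: nat
  assumes "local_field_extension vK vL \<iota>"
    and "residue_characteristic vK p"
    and "totally_ramified vK vL \<iota>"
    and "strongly_separable p vK vL \<iota>"
    and "n = ext_degree \<iota>"
  shows "let (I, \<beta>) = ext_jump_set p vK vL \<iota> in
     lower_convex_hull
       ((\<lambda>i. (real (p ^ (\<beta> i - 1)), real (p ^ (\<beta> i - 1) * i))) ` I \<union> {(real n, real n)})
       = Newt vK vL \<iota> \<and>
     (\<forall>g. eisenstein vK g \<and> (\<exists>\<pi>. presents \<iota> g \<pi>) \<longrightarrow> (I, \<beta>) = poly_jump_set p vK g)"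
proof -
  interpret local_field_extension vK vL \<iota> by fact
  let ?J = "ext_jump_set p vK vL \<iota>"
  have sse: "strongly_separable_extension vK vL \<iota> n \<pi> g p"
    if "eisenstein vK g" "presents \<iota> g \<pi>" for g \<pi>
    using presented_eisenstein_extension[OF assms(3) that] assms(2,4,5)
    by (simp add: strongly_separable_extension_def strongly_separable_extension_axioms_def)
  have polygon: "newton_polygon vL (twist_poly \<iota> g \<pi>) = lower_convex_hull (jump_points p n ?J)"
    and poly: "poly_jump_set p vK g = ?J"
    if "eisenstein vK g" "presents \<iota> g \<pi>" for g \<pi>
    using strongly_separable_extension.newton_polygon_eq[OF sse[OF that]]
      strongly_separable_extension.poly_jump_set_eq[OF sse[OF that]]
      strongly_separable_extension.ext_jump_set_eq[OF sse[OF that]] by simp_all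
  obtain \<pi> where \<pi>: "\<pi> \<noteq> 0" "vL \<pi> = 1" using L.val_normalized by blast
  interpret uniformized_extension vK vL \<iota> n \<pi>
    by unfold_locales (use assms \<pi> in auto)
  obtain g where g: "eisenstein vK g" "presents \<iota> g \<pi>" using eisenstein_polynomial_exists by blast
  have "Newt vK vL \<iota> = lower_convex_hull (jump_points p n ?J)"
    unfolding Newt_def
  proof (rule the_equality)
    show "\<exists>g \<pi>. eisenstein vK g \<and> presents \<iota> g \<pi> \<and>
        lower_convex_hull (jump_points p n ?J) = newton_polygon vL (twist_poly \<iota> g \<pi>)"
      using g polygon[OF g] by metis
  qed (use polygon in auto)
  moreover have "lower_convex_hull (jump_points p n ?J)
      = (case ?J of (I, \<beta>) \<Rightarrow> lower_convex_hull
          ((\<lambda>i. (real (p ^ (\<beta> i - 1)), real (p ^ (\<beta> i - 1) * i))) ` I \<union> {(real n, real n)}))"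
    by (simp add: jump_points_def split: prod.split)
  ultimately show ?thesis
    using poly by (auto simp: split: prod.splits)
qed

end
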